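(* Let $a_n>0$, $b_n\in\mathbb R$ ($n\ge 0$) satisfy, as $n\to\infty$, $$a_n=n^{\sigma}\bigl(1+\alpha n^{-1}+O(n^{-2})\bigr),\qquad b_n=2\gamma n^{\sigma}\bigl(1+\beta n^{-1}+O(n^{-2})\bigr)$$ with $\alpha,\beta\in\mathbb R$, $|\gamma|=1$ and $\sigma>3/2$. Put $\tau=2\beta-2\alpha+\sigma$, and let $J_0$ be the minimal Jacobi operator with coefficients $a_n,b_n$. 1. If $\tau<0$, then $J_0$ has deficiency indices $(1,1)$, and the spectra of all its self-adjoint extensions are discrete. 2. If $\tau>0$, then $J_0$ is essentially self-adjoint, and the spectrum of its closure is discrete and semi-bounded: from below if $\gamma=1$ (from above if $\gamma=-1$).
   Context: The minimal Jacobi operator $J_0$ in $\ell^2(\mathbb Z_+)$, $\mathbb Z_+=\{0,1,\dots\}$, is defined on the set of finitely supported sequences $u=(u_0,u_1,\dots)$ by $(J_0u)_n=a_{n-1}u_{n-1}+b_nu_n+a_nu_{n+1}$ (with $u_{-1}=0$); it is symmetric. *)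

theory Defs
  imports "HOL-Analysis.Analysis" "HOL-Library.Landau_Symbols" "HOL-Library.Extended_Nat"
begin

typedef ell2 = "{u :: nat \<Rightarrow> complex. summable (\<lambda>n. (cmod (u n))\<^sup>2)}"
  morphisms coord Abs_ell2
  by (rule exI[of _ "\<lambda>_. 0"]) simp

setup_lifting type_definition_ell2

lemma summable_coord: "summable (\<lambda>n. (cmod (coord u n))\<^sup>2)"
  using coord[of u] by simp

lemma ell2_eqI: "(\<And>n. coord u n = coord v n) \<Longrightarrow> u = v"
  by (rule iffD1[OF coord_inject], rule ext)

lemma square_summable_add:
  fixes u v :: "nat \<Rightarrow> complex"
  assumes "summable (\<lambda>n. (cmod (u n))\<^sup>2)" "summable (\<lambda>n. (cmod (v n))\<^sup>2)"
  shows "summable (\<lambda>n. (cmod (u n + v n))\<^sup>2)"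
proof (rule summable_comparison_test')
  show "summable (\<lambda>n. 2 * (cmod (u n))\<^sup>2 + 2 * (cmod (v n))\<^sup>2)"
    by (intro summable_add summable_mult assms)
next
  fix n :: nat
  have "(cmod (u n + v n))\<^sup>2 \<le> (cmod (u n) + cmod (v n))\<^sup>2"
    by (simp add: norm_triangle_ineq power_mono)
  also have "\<dots> \<le> 2 * (cmod (u n))\<^sup>2 + 2 * (cmod (v n))\<^sup>2"
    using zero_le_power2[of "cmod (u n) - cmod (v n)"]
    by (simp add: power2_sum power2_diff)
  finally show "norm ((cmod (u n + v n))\<^sup>2) \<le> 2 * (cmod (u n))\<^sup>2 + 2 * (cmod (v n))\<^sup>2"
    by simp
qed

lemma square_summable_scale:
  fixes u :: "nat \<Rightarrow> complex"
  assumes "summable (\<lambda>n. (cmod (u n))\<^sup>2)"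
  shows "summable (\<lambda>n. (cmod (c * u n))\<^sup>2)"
  using summable_mult[OF assms, of "(cmod c)\<^sup>2"] by (simp add: norm_mult power_mult_distrib)

lemma summable_cinner:
  "summable (\<lambda>n. coord u n * cnj (coord v n))"
proof (rule summable_comparison_test')
  show "summable (\<lambda>n. (cmod (coord u n))\<^sup>2 + (cmod (coord v n))\<^sup>2)"
    by (intro summable_add summable_coord)
next
  fix n :: nat
  have "0 \<le> (cmod (coord u n) - cmod (coord v n))\<^sup>2" "0 \<le> cmod (coord u n) * cmod (coord v n)"
    by simp_all
  then show "norm (coord u n * cnj (coord v n)) \<le> (cmod (coord u n))\<^sup>2 + (cmod (coord v n))\<^sup>2"
    unfolding power2_diff norm_mult complex_mod_cnj by linarith
qed

definition cinner :: "ell2 \<Rightarrow> ell2 \<Rightarrow> complex" where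
  "cinner u v = (\<Sum>n. coord u n * cnj (coord v n))"

lift_definition scaleC :: "complex \<Rightarrow> ell2 \<Rightarrow> ell2" (infixr \<open>*\<^sub>C\<close> 75)
  is "\<lambda>c u n. c * u n"
  by (rule square_summable_scale)

instantiation ell2 :: real_vector
begin

lift_definition zero_ell2 :: ell2 is "\<lambda>_. 0" by simp
lift_definition plus_ell2 :: "ell2 \<Rightarrow> ell2 \<Rightarrow> ell2" is "\<lambda>u v n. u n + v n"
  by (rule square_summable_add)
lift_definition uminus_ell2 :: "ell2 \<Rightarrow> ell2" is "\<lambda>u n. - u n" by simp
definition minus_ell2 :: "ell2 \<Rightarrow> ell2 \<Rightarrow> ell2" where "minus_ell2 u v = u + (- v)"
definition scaleR_ell2 :: "real \<Rightarrow> ell2 \<Rightarrow> ell2" where "scaleR_ell2 r u = complex_of_real r *\<^sub>C u"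

instance
  by standard
    (auto intro!: ell2_eqI simp: minus_ell2_def scaleR_ell2_def zero_ell2.rep_eq plus_ell2.rep_eq
      uminus_ell2.rep_eq scaleC.rep_eq algebra_simps)

end

lemma coord_zero [simp]: "coord 0 n = 0" by (simp add: zero_ell2.rep_eq)
lemma coord_add [simp]: "coord (u + v) n = coord u n + coord v n" by (simp add: plus_ell2.rep_eq)
lemma coord_uminus [simp]: "coord (- u) n = - coord u n" by (simp add: uminus_ell2.rep_eq)
lemma coord_diff [simp]: "coord (u - v) n = coord u n - coord v n"
  unfolding minus_ell2_def by (simp only: coord_add coord_uminus diff_conv_add_uminus)
lemma coord_scaleC [simp]: "coord (c *\<^sub>C u) n = c * coord u n" by (simp add: scaleC.rep_eq)
lemma coord_scaleR [simp]: "coord (r *\<^sub>R u) n = complex_of_real r * coord u n"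
  by (simp add: scaleR_ell2_def)

interpretation complex_ell2: vector_space scaleC
  by unfold_locales (rule ell2_eqI, simp add: distrib_left distrib_right)+

lemma cinner_add_left: "cinner (u + v) w = cinner u w + cinner v w"
  unfolding cinner_def
  by (subst suminf_add[OF summable_cinner summable_cinner]) (simp add: algebra_simps)

lemma cinner_scaleC_left: "cinner (c *\<^sub>C u) v = c * cinner u v"
  unfolding cinner_def
  by (subst suminf_mult[OF summable_cinner, symmetric]) (simp add: algebra_simps)

lemma cinner_commute: "cinner u v = cnj (cinner v u)"
proof -
  have "(\<lambda>n. cnj (coord v n * cnj (coord u n))) sums cnj (cinner v u)"
    unfolding cinner_def sums_cnj by (rule summable_sums[OF summable_cinner])
  then have "(\<lambda>n. coord u n * cnj (coord v n)) sums cnj (cinner v u)"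
    by (simp add: mult.commute)
  then show ?thesis
    unfolding cinner_def[of u v] by (rule sums_unique[symmetric])
qed

lemma cinner_self: "cinner u u = complex_of_real (\<Sum>n. (cmod (coord u n))\<^sup>2)"
proof -
  have "(\<lambda>n. complex_of_real ((cmod (coord u n))\<^sup>2)) sums complex_of_real (\<Sum>n. (cmod (coord u n))\<^sup>2)"
    by (intro sums_of_real summable_sums summable_coord)
  then have "(\<lambda>n. coord u n * cnj (coord u n)) sums complex_of_real (\<Sum>n. (cmod (coord u n))\<^sup>2)"
    by (simp only: complex_norm_square)
  then show ?thesis
    unfolding cinner_def by (rule sums_unique[symmetric])
qed

instantiation ell2 :: real_inner
begin

definition inner_ell2 :: "ell2 \<Rightarrow> ell2 \<Rightarrow> real" where "inner_ell2 u v = Re (cinner u v)"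
definition norm_ell2 :: "ell2 \<Rightarrow> real" where "norm_ell2 u = sqrt (inner u u)"
definition sgn_ell2 :: "ell2 \<Rightarrow> ell2" where "sgn_ell2 u = inverse (norm u) *\<^sub>R u"
definition dist_ell2 :: "ell2 \<Rightarrow> ell2 \<Rightarrow> real" where "dist_ell2 u v = norm (u - v)"
definition uniformity_ell2 :: "(ell2 \<times> ell2) filter" where
  "uniformity_ell2 = (INF e\<in>{0<..}. principal {(u, v). dist u v < e})"
definition open_ell2 :: "ell2 set \<Rightarrow> bool" where
  "open_ell2 U = (\<forall>u\<in>U. \<forall>\<^sub>F (u', v) in uniformity. u' = u \<longrightarrow> v \<in> U)"

instance
proof
  fix u v w :: ell2 and r :: real
  show "inner u v = inner v u"
    unfolding inner_ell2_def by (subst cinner_commute[of u v]) simp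
  show "inner (u + v) w = inner u w + inner v w"
    by (simp add: inner_ell2_def cinner_add_left)
  show "inner (r *\<^sub>R u) v = r * inner u v"
    by (simp add: inner_ell2_def scaleR_ell2_def cinner_scaleC_left)
  have self: "inner u u = (\<Sum>n. (cmod (coord u n))\<^sup>2)"
    by (simp add: inner_ell2_def cinner_self)
  show "0 \<le> inner u u"
    unfolding self by (intro suminf_nonneg summable_coord) simp
  show "(inner u u = 0) = (u = 0)"
    unfolding self by (subst suminf_eq_zero_iff[OF summable_coord]) (auto intro: ell2_eqI)
qed (rule dist_ell2_def sgn_ell2_def uniformity_ell2_def open_ell2_def norm_ell2_def)+

end

lemma norm_ell2_eq: "norm u = sqrt (\<Sum>n. (cmod (coord u n))\<^sup>2)"
  by (simp add: norm_ell2_def inner_ell2_def cinner_self)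

definition cdim :: "ell2 set \<Rightarrow> enat" where
  "cdim V = (if \<exists>B. finite B \<and> V \<subseteq> complex_ell2.span B
             then enat (complex_ell2.dim V) else \<infinity>)"

text \<open>An operator is identified with its graph: a pair \<open>(u, f)\<close> in \<open>A\<close> means that \<open>u\<close> lies in the
  domain of \<open>A\<close> and \<open>A u = f\<close>. Hence an extension of \<open>A\<close> is a superset, and the closure of \<open>A\<close> is
  the topological closure of the graph in \<open>ell2 \<times> ell2\<close>.\<close>

type_synonym operator = "(ell2 \<times> ell2) set"

definition linear_operator :: "operator \<Rightarrow> bool" where
  "linear_operator A \<longleftrightarrow> single_valued A \<and> (0, 0) \<in> A \<and>
     (\<forall>u f v g. (u, f) \<in> A \<longrightarrow> (v, g) \<in> A \<longrightarrow> (u + v, f + g) \<in> A) \<and>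
     (\<forall>c u f. (u, f) \<in> A \<longrightarrow> (c *\<^sub>C u, c *\<^sub>C f) \<in> A)"

definition densely_defined :: "operator \<Rightarrow> bool" where
  "densely_defined A \<longleftrightarrow> closure (Domain A) = UNIV"

definition adjoint_operator :: "operator \<Rightarrow> operator" where
  "adjoint_operator A = {(v, g). \<forall>(u, f)\<in>A. cinner f v = cinner u g}"

definition self_adjoint :: "operator \<Rightarrow> bool" where
  "self_adjoint A \<longleftrightarrow> linear_operator A \<and> densely_defined A \<and> adjoint_operator A = A"

definition essentially_self_adjoint :: "operator \<Rightarrow> bool" where
  "essentially_self_adjoint A \<longleftrightarrow> self_adjoint (closure A)"

definition eigenspace :: "operator \<Rightarrow> complex \<Rightarrow> ell2 set" where
  "eigenspace A z = {u. (u, z *\<^sub>C u) \<in> A}"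

definition deficiency_indices :: "operator \<Rightarrow> enat \<times> enat" where
  "deficiency_indices A =
     (cdim (eigenspace (adjoint_operator A) \<i>), cdim (eigenspace (adjoint_operator A) (- \<i>)))"

text \<open>\<open>z\<close> is in the resolvent set if \<open>A - z\<close> maps the domain of \<open>A\<close> bijectively onto the whole
  space, with bounded inverse \<open>R\<close>; below, the converse of the graph of \<open>A - z\<close> is the graph of
  \<open>R\<close>. For a linear operator \<open>A\<close>, such a real-linear \<open>R\<close> is automatically complex-linear.\<close>

definition resolvent_set :: "operator \<Rightarrow> complex set" where
  "resolvent_set A =
     {z. \<exists>R :: ell2 \<Rightarrow> ell2. bounded_linear R \<and>
           {(f - z *\<^sub>C u, u) | u f. (u, f) \<in> A} = {(g, R g) | g. True}}"

definition spectrum :: "operator \<Rightarrow> complex set" where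
  "spectrum A = - resolvent_set A"

definition discrete_spectrum :: "operator \<Rightarrow> bool" where
  "discrete_spectrum A \<longleftrightarrow>
     (\<forall>z\<in>spectrum A. z isolated_in spectrum A \<and>
        0 < cdim (eigenspace A z) \<and> cdim (eigenspace A z) < \<infinity>)"

definition jacobi_min :: "(nat \<Rightarrow> real) \<Rightarrow> (nat \<Rightarrow> real) \<Rightarrow> operator" where
  "jacobi_min a b =
     {(u, f). finite {n. coord u n \<noteq> 0} \<and>
        (\<forall>n. coord f n =
           (if n = 0 then 0 else complex_of_real (a (n - 1)) * coord u (n - 1))
           + complex_of_real (b n) * coord u n
           + complex_of_real (a n) * coord u (n + 1))}"

lemma Domain_jacobi_min: "Domain (jacobi_min a b) = {u. finite {n. coord u n \<noteq> 0}}"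
proof (intro equalityI subsetI)
  fix u assume "u \<in> {u. finite {n. coord u n \<noteq> 0}}"
  then have fin: "finite {n. coord u n \<noteq> 0}" by simp
  define h where "h n = (if n = 0 then 0 else complex_of_real (a (n - 1)) * coord u (n - 1))
    + complex_of_real (b n) * coord u n + complex_of_real (a n) * coord u (n + 1)" for n
  from fin obtain N where N: "\<And>n. coord u n \<noteq> 0 \<Longrightarrow> n \<le> N"
    by (auto simp: finite_nat_set_iff_bounded_le)
  have "h n = 0" if "n \<notin> {..Suc N}" for n
  proof -
    have "\<not> n - 1 \<le> N" "\<not> n \<le> N" "\<not> n + 1 \<le> N"
      using that by auto
    then have "coord u (n - 1) = 0" "coord u n = 0" "coord u (n + 1) = 0"
      using N by blast+
    then show ?thesis by (simp add: h_def)
  qed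
  then have "summable (\<lambda>n. (cmod (h n))\<^sup>2)"
    by (intro summable_finite[of "{..Suc N}"]) auto
  then have "coord (Abs_ell2 h) = h" by (simp add: Abs_ell2_inverse)
  then have "(u, Abs_ell2 h) \<in> jacobi_min a b"
    using fin by (simp add: jacobi_min_def h_def)
  then show "u \<in> Domain (jacobi_min a b)" by blast
qed (auto simp: jacobi_min_def)

end

theory Submission
  imports Defs "HOL-Real_Asymp.Real_Asymp" "HOL-Complex_Analysis.Great_Picard"
begin

text \<open>
  Put \<open>p\<^sub>n = (-\<gamma>)^n u\<^sub>n\<close> and \<open>w\<^sub>n = \<gamma> b\<^sub>n - a\<^sub>n - a\<^sub>n\<^sub>-\<^sub>1\<close>, so that \<open>w\<^sub>n = \<tau> n^(\<sigma>-1) + O(n^(\<sigma>-2))\<close>. Up to a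
  sign and the factor \<open>(-\<gamma>)^n\<close>, \<open>J u\<close> is \<open>w\<^sub>n p\<^sub>n - (a\<^sub>n (p\<^sub>n\<^sub>+\<^sub>1 - p\<^sub>n) - a\<^sub>n\<^sub>-\<^sub>1 (p\<^sub>n - p\<^sub>n\<^sub>-\<^sub>1))\<close>.

  If \<open>\<tau> > 0\<close>, then \<open>w\<^sub>n\<close> tends to infinity, and \<open>\<gamma> \<langle>J u, u\<rangle>\<close> is the sum of
  \<open>a\<^sub>n |p\<^sub>n\<^sub>+\<^sub>1 - p\<^sub>n|\<^sup>2 + w\<^sub>n |p\<^sub>n|\<^sup>2\<close>. The operator is therefore semi-bounded, and a bounded subset of
  its graph has uniformly small tails. For large \<open>c\<close> the modulus of a solution of \<open>J u = - \<gamma> c u\<close> is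
  nondecreasing, so that none is square summable and the closure is self-adjoint.

  If \<open>\<tau> < 0\<close>, put \<open>\<kappa> = - \<tau>\<close>, \<open>s = \<sigma> - 1/2\<close> and \<open>q\<^sub>n = a\<^sub>n\<^sub>-\<^sub>1 (p\<^sub>n - p\<^sub>n\<^sub>-\<^sub>1)\<close>. The energy
  \<open>\<kappa> n^s |p\<^sub>n|\<^sup>2 + (s - \<kappa>) n^(-1/2) Re (p\<^sub>n q\<^sub>n\<^sup>*) + n^(-s) |q\<^sub>n|\<^sup>2\<close>, modelled on the WKB solutions, grows at
  most by a factor \<open>1 + O(n^(-min (3/2) s))\<close> in each step, hence stays bounded. So all solutions of
  \<open>J u = z u\<close> are \<open>O(n^(-s/2))\<close> and square summable, and the elements of a bounded subset of the graph
  of the maximal operator have a common square summable majorant.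

  In both cases bounded subsets of the graph have relatively compact projections to the domain.
  For a self-adjoint operator this forces every spectral point to be an isolated eigenvalue; its
  multiplicity is one by the three-term recurrence.
\<close>

subsection \<open>The Hilbert space of square summable sequences\<close>

lemma norm_ell2_sq: "(norm u)\<^sup>2 = (\<Sum>n. (cmod (coord u n))\<^sup>2)"
  by (simp add: norm_ell2_eq suminf_nonneg summable_coord)

lemma sum_coord_le: "finite A \<Longrightarrow> (\<Sum>n\<in>A. (cmod (coord u n))\<^sup>2) \<le> (norm u)\<^sup>2"
  unfolding norm_ell2_sq by (intro sum_le_suminf summable_coord) auto

lemma norm_coord_le: "cmod (coord u n) \<le> norm u"
proof -
  have "(cmod (coord u n))\<^sup>2 \<le> (norm u)\<^sup>2"
    using sum_coord_le[of "{n}" u] by simp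
  then show ?thesis
    by (rule power2_le_imp_le) simp
qed

lemma norm_scaleC: "norm (c *\<^sub>C u) = cmod c * norm u"
proof (rule power2_eq_imp_eq)
  show "(norm (c *\<^sub>C u))\<^sup>2 = (cmod c * norm u)\<^sup>2"
    unfolding power_mult_distrib norm_ell2_sq
    by (subst suminf_mult[OF summable_coord, symmetric]) (simp add: norm_mult power_mult_distrib)
qed simp_all

lemma bounded_linear_coord: "bounded_linear (\<lambda>u. coord u n)"
  by (rule bounded_linear_intro[where K = 1]) (auto simp: norm_coord_le scaleR_conv_of_real)

lemmas continuous_on_coord = bounded_linear.continuous_on[OF bounded_linear_coord]

lemma bounded_linear_scaleC: "bounded_linear (\<lambda>u. c *\<^sub>C u)"
  by (rule bounded_linear_intro[where K = "cmod c"])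
    (auto simp: norm_scaleC mult.commute intro!: ell2_eqI simp: algebra_simps)

lemmas tendsto_scaleC = bounded_linear.tendsto[OF bounded_linear_scaleC]

text \<open>Multiplying by \<open>-\<i>\<close> moves the imaginary part into the real part, so
  continuity and orthogonality for \<open>cinner\<close> reduce to the real
  \<open>inner\<close>.\<close>

lemma cinner_eq: "cinner u v = Complex (inner u v) (inner ((- \<i>) *\<^sub>C u) v)"
  by (simp add: inner_ell2_def cinner_scaleC_left complex_eq_iff del: complex_ell2.scale_minus_left)

lemma continuous_on_cinner [continuous_intros]:
  assumes "continuous_on S f" "continuous_on S g"
  shows "continuous_on S (\<lambda>x. cinner (f x) (g x))"
  unfolding cinner_eq complex_eq_cancel_iff2 Complex_eq
  by (intro continuous_intros assms bounded_linear.continuous_on[OF bounded_linear_scaleC])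

section \<open>Compactness criterion and completeness\<close>

lemma power2_norm_add_le:
  fixes x y :: "'a :: real_normed_vector"
  shows "(norm (x + y))\<^sup>2 \<le> 2 * (norm x)\<^sup>2 + 2 * (norm y)\<^sup>2"
proof -
  have "(norm (x + y))\<^sup>2 \<le> (norm x + norm y)\<^sup>2"
    by (intro power_mono norm_triangle_ineq) simp
  also have "\<dots> \<le> 2 * (norm x)\<^sup>2 + 2 * (norm y)\<^sup>2"
    using zero_le_power2[of "norm x - norm y"] by (simp add: power2_sum power2_diff)
  finally show ?thesis .
qed

text \<open>A diagonal extraction gives coordinatewise convergence, and uniformly small tails
  upgrade it to norm convergence. The tail condition is asked only for large \<open>k\<close>, so
  that Cauchy sequences meet it as well.\<close>

lemma square_summable_conv_subseq:
  fixes u :: "nat \<Rightarrow> ell2"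
  assumes bound: "\<And>k. norm (u k) \<le> K"
    and tail: "\<And>\<epsilon>. \<epsilon> > 0 \<Longrightarrow> \<exists>N. \<forall>\<^sub>F k in sequentially. \<forall>M. (\<Sum>n=N..<M. (cmod (coord (u k) n))\<^sup>2) \<le> \<epsilon>"
  obtains \<phi> L where "strict_mono \<phi>" "(u \<circ> \<phi>) \<longlonglongrightarrow> L"
proof -
  obtain \<phi> where \<phi>: "strict_mono \<phi>"
    and conv: "\<And>n. \<exists>l. (\<lambda>k. coord (u (\<phi> k)) n) \<longlonglongrightarrow> l"
  proof (rule function_convergent_subsequence[of "UNIV :: nat set" "\<lambda>k. coord (u k)" K])
    show "norm (coord (u k) n) \<le> K" for k n
      using norm_coord_le[of "u k" n] bound[of k] by linarith
  qed auto
  then obtain l where l: "\<And>n. (\<lambda>k. coord (u (\<phi> k)) n) \<longlonglongrightarrow> l n"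
    by metis
  have sum_lim: "(\<lambda>k. \<Sum>n\<in>A. (cmod (coord (u (\<phi> k)) n))\<^sup>2) \<longlonglongrightarrow> (\<Sum>n\<in>A. (cmod (l n))\<^sup>2)" for A
    by (intro tendsto_intros l)
  have "(\<Sum>n<M. (cmod (l n))\<^sup>2) \<le> K\<^sup>2" for M
  proof (rule tendsto_upperbound[OF sum_lim])
    have "(\<Sum>n<M. (cmod (coord (u (\<phi> k)) n))\<^sup>2) \<le> K\<^sup>2" for k
      using sum_coord_le[of "{..<M}" "u (\<phi> k)"] power_mono[OF bound[of "\<phi> k"], of 2] by simp
    then show "\<forall>\<^sub>F k in sequentially. (\<Sum>n<M. (cmod (coord (u (\<phi> k)) n))\<^sup>2) \<le> K\<^sup>2"
      by simp
  qed simp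
  then have "summable (\<lambda>n. (cmod (l n))\<^sup>2)"
    by (intro summableI_nonneg_bounded) auto
  then have L: "coord (Abs_ell2 l) = l"
    by (simp add: Abs_ell2_inverse)
  have "(\<lambda>k. norm (u (\<phi> k) - Abs_ell2 l)) \<longlonglongrightarrow> 0"
  proof (rule tendstoI)
    fix e :: real assume e: "e > 0"
    \<comment> \<open>The head will contribute less than \<open>\<epsilon>\<close> and the two tails
      at most \<open>2 * \<epsilon>\<close> each; \<open>5 * \<epsilon>\<close> is still below
      \<open>e\<^sup>2\<close>.\<close>
    define \<epsilon> where "\<epsilon> = e\<^sup>2 / 6"
    have \<epsilon>: "\<epsilon> > 0" using e by (simp add: \<epsilon>_def)
    obtain N where N: "\<forall>\<^sub>F k in sequentially. \<forall>M. (\<Sum>n=N..<M. (cmod (coord (u k) n))\<^sup>2) \<le> \<epsilon>"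
      using tail[OF \<epsilon>] by blast
    have N': "\<forall>\<^sub>F k in sequentially. \<forall>M. (\<Sum>n=N..<M. (cmod (coord (u (\<phi> k)) n))\<^sup>2) \<le> \<epsilon>"
      using eventually_subseq[OF \<phi> N] .
    have lt: "(\<Sum>n=N..<M. (cmod (l n))\<^sup>2) \<le> \<epsilon>" for M
      by (rule tendsto_upperbound[OF sum_lim])
        (auto intro: eventually_mono[OF N'])
    have "(\<lambda>k. \<Sum>n<N. (cmod (coord (u (\<phi> k)) n - l n))\<^sup>2) \<longlonglongrightarrow> (\<Sum>n<N. (cmod (l n - l n))\<^sup>2)"
      by (intro tendsto_intros l)
    then have "\<forall>\<^sub>F k in sequentially. (\<Sum>n<N. (cmod (coord (u (\<phi> k)) n - l n))\<^sup>2) < \<epsilon>"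
      using \<epsilon> by (intro order_tendstoD(2)) auto
    then show "\<forall>\<^sub>F k in sequentially. dist (norm (u (\<phi> k) - Abs_ell2 l)) 0 < e"
      using N'
    proof eventually_elim
      case (elim k)
      have "(\<Sum>n<M. (cmod (coord (u (\<phi> k) - Abs_ell2 l) n))\<^sup>2) \<le> 5 * \<epsilon>" for M
      proof -
        have "(\<Sum>n<M. (cmod (coord (u (\<phi> k) - Abs_ell2 l) n))\<^sup>2)
            \<le> (\<Sum>n\<in>{..<N} \<union> {N..<M}. (cmod (coord (u (\<phi> k)) n - l n))\<^sup>2)"
          unfolding coord_diff L by (rule sum_mono2) auto
        also have "\<dots> = (\<Sum>n<N. (cmod (coord (u (\<phi> k)) n - l n))\<^sup>2)
            + (\<Sum>n=N..<M. (cmod (coord (u (\<phi> k)) n - l n))\<^sup>2)"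
          by (rule sum.union_disjoint) auto
        also have "(\<Sum>n=N..<M. (cmod (coord (u (\<phi> k)) n - l n))\<^sup>2)
            \<le> (\<Sum>n=N..<M. 2 * (cmod (coord (u (\<phi> k)) n))\<^sup>2 + 2 * (cmod (l n))\<^sup>2)"
          using power2_norm_add_le[of "coord (u (\<phi> k)) n" "- l n" for n]
          by (intro sum_mono) simp
        also have "\<dots> = 2 * (\<Sum>n=N..<M. (cmod (coord (u (\<phi> k)) n))\<^sup>2) + 2 * (\<Sum>n=N..<M. (cmod (l n))\<^sup>2)"
          by (simp add: sum.distrib sum_distrib_left)
        finally show ?thesis
          using elim lt[of M] by (smt (verit))
      qed
      then have "(norm (u (\<phi> k) - Abs_ell2 l))\<^sup>2 \<le> 5 * \<epsilon>"
        unfolding norm_ell2_sq by (intro suminf_le_const summable_coord) auto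
      also have "\<dots> < e\<^sup>2"
        using e by (simp add: \<epsilon>_def)
      finally show ?case
        using e by (simp add: power2_less_imp_less)
    qed
  qed
  then have "(u \<circ> \<phi>) \<longlonglongrightarrow> Abs_ell2 l"
    by (simp add: o_def LIM_zero_iff tendsto_norm_zero_iff)
  with \<phi> show thesis by (rule that)
qed

text \<open>From some \<open>k0\<close> on, a Cauchy sequence stays close in norm to the single
  member \<open>u k0\<close>, whose own tail is small; the tails are thus uniformly small and the
  subsequence criterion applies.\<close>

instance ell2 :: complete_space
proof
  fix u :: "nat \<Rightarrow> ell2"
  assume u: "Cauchy u"
  obtain K where K: "\<And>k. norm (u k) \<le> K"
    using cauchy_imp_bounded[OF u] by (auto simp: bounded_iff)
  obtain \<phi> L where \<phi>: "strict_mono \<phi>" "(u \<circ> \<phi>) \<longlonglongrightarrow> L"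
  proof (rule square_summable_conv_subseq[OF K])
    fix \<epsilon> :: real assume \<epsilon>: "\<epsilon> > 0"
    obtain k0 where k0: "\<And>k. k \<ge> k0 \<Longrightarrow> dist (u k) (u k0) < sqrt (\<epsilon> / 4)"
      using u \<epsilon> unfolding Cauchy_altdef2 by (metis divide_pos_pos real_sqrt_gt_0_iff zero_less_numeral)
    obtain N where N: "\<And>M. norm (\<Sum>n=N..<M. (cmod (coord (u k0) n))\<^sup>2) < \<epsilon> / 4"
      using summable_coord[of "u k0"] \<epsilon> unfolding summable_Cauchy
      by (metis divide_pos_pos order_refl zero_less_numeral)
    have "(\<Sum>n=N..<M. (cmod (coord (u k) n))\<^sup>2) \<le> \<epsilon>" if "k \<ge> k0" for k M
    proof -
      have "(\<Sum>n=N..<M. (cmod (coord (u k) n))\<^sup>2)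
          \<le> (\<Sum>n=N..<M. 2 * (cmod (coord (u k - u k0) n))\<^sup>2 + 2 * (cmod (coord (u k0) n))\<^sup>2)"
        using power2_norm_add_le[of "coord (u k - u k0) n" "coord (u k0) n" for n]
        by (intro sum_mono) simp
      also have "\<dots> = 2 * (\<Sum>n=N..<M. (cmod (coord (u k - u k0) n))\<^sup>2)
          + 2 * (\<Sum>n=N..<M. (cmod (coord (u k0) n))\<^sup>2)"
        by (simp only: sum.distrib sum_distrib_left)
      also have "(\<Sum>n=N..<M. (cmod (coord (u k - u k0) n))\<^sup>2) \<le> (norm (u k - u k0))\<^sup>2"
        by (rule sum_coord_le) simp
      also have "\<dots> \<le> (sqrt (\<epsilon> / 4))\<^sup>2"
        using k0[OF that] by (intro power_mono) (auto simp: dist_norm)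
      also have "\<dots> = \<epsilon> / 4"
        using \<epsilon> by simp
      finally show ?thesis
        using N[of M] by simp
    qed
    then show "\<exists>N. \<forall>\<^sub>F k in sequentially. \<forall>M. (\<Sum>n=N..<M. (cmod (coord (u k) n))\<^sup>2) \<le> \<epsilon>"
      unfolding eventually_sequentially by blast
  qed
  show "convergent u"
    using Cauchy_converges_subseq[OF u \<phi>] by (auto simp: convergent_def)
qed

subsection \<open>Closed subspaces and resolvents\<close>

text \<open>For \<open>x\<close> outside \<open>S\<close>, a minimising sequence converges by
  completeness to a nearest point \<open>t\<close>, and \<open>x - t\<close> is orthogonal to
  \<open>S\<close>.\<close>

lemma exists_orthogonal_vector:
  fixes S :: "'a :: {real_inner, complete_space} set"
  assumes S: "closed S" "subspace S" "S \<noteq> UNIV"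
  obtains g where "g \<noteq> 0" "\<And>s. s \<in> S \<Longrightarrow> inner s g = 0"
proof -
  obtain x where x: "x \<notin> S" using S by blast
  have ne: "S \<noteq> {}" using subspace_0[OF S(2)] by blast
  define d where "d = infdist x S"
  have d: "d \<ge> 0" "\<And>s. s \<in> S \<Longrightarrow> d \<le> norm (x - s)"
    by (auto simp: d_def infdist_nonneg infdist_le dist_norm[symmetric])
  have "\<exists>s\<in>S. norm (x - s) < d + 1 / real (Suc n)" for n
  proof (rule ccontr)
    assume "\<not> ?thesis"
    then have "d + 1 / real (Suc n) \<le> infdist x S"
      unfolding infdist_notempty[OF ne] by (intro cINF_greatest ne) (auto simp: dist_norm not_less)
    then show False by (simp add: d_def)
  qed
  then obtain s where s: "\<And>n. s n \<in> S" "\<And>n. norm (x - s n) < d + 1 / real (Suc n)"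
    by metis
  have lim: "(\<lambda>n. (d + 1 / real (Suc n))\<^sup>2) \<longlonglongrightarrow> (d + 0)\<^sup>2"
    by (intro tendsto_intros LIMSEQ_inverse_real_of_nat[unfolded inverse_eq_divide])
  have "Cauchy s"
  proof (rule metric_CauchyI)
    fix e :: real assume "e > 0"
    then have "d\<^sup>2 < d\<^sup>2 + e\<^sup>2 / 4" by simp
    then obtain N where N: "\<And>n. n \<ge> N \<Longrightarrow> (d + 1 / real (Suc n))\<^sup>2 < d\<^sup>2 + e\<^sup>2 / 4"
      using order_tendstoD(2)[OF lim] unfolding eventually_sequentially by (metis add.right_neutral)
    have "dist (s m) (s n) < e" if mn: "m \<ge> N" "n \<ge> N" for m n
    proof -
      \<comment> \<open>The midpoint stays in \<open>S\<close>, so its distance to \<open>x\<close>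
        is at least \<open>d\<close>; the parallelogram law then bounds
        \<open>s m - s n\<close>.\<close>
      have "(1/2) *\<^sub>R (s m + s n) \<in> S"
        by (intro subspace_scale subspace_add S s)
      then have "d\<^sup>2 \<le> (norm (x - (1/2) *\<^sub>R (s m + s n)))\<^sup>2"
        using d by (intro power_mono) auto
      moreover have "(norm (s m - s n))\<^sup>2 = 2 * (norm (x - s m))\<^sup>2 + 2 * (norm (x - s n))\<^sup>2
          - 4 * (norm (x - (1/2) *\<^sub>R (s m + s n)))\<^sup>2"
        by (simp add: power2_norm_eq_inner inner_simps inner_commute algebra_simps)
      moreover have close: "(norm (x - s k))\<^sup>2 < d\<^sup>2 + e\<^sup>2 / 4" if "k \<ge> N" for k
        using N[OF that] s(2)[of k] power_mono[of "norm (x - s k)" "d + 1 / real (Suc k)" 2] by simp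
      ultimately have "(norm (s m - s n))\<^sup>2 < e\<^sup>2"
        using close[OF mn(1)] close[OF mn(2)] by linarith
      then show ?thesis
        using \<open>e > 0\<close> by (simp add: dist_norm power2_less_imp_less)
    qed
    then show "\<exists>N. \<forall>m\<ge>N. \<forall>n\<ge>N. dist (s m) (s n) < e" by blast
  qed
  then obtain t where t: "s \<longlonglongrightarrow> t"
    using Cauchy_convergent convergent_def by blast
  have tS: "t \<in> S"
    using closed_sequentially[OF S(1)] s(1) t by blast
  have "norm (x - t) \<le> d + 0"
  proof (rule LIMSEQ_le)
    show "(\<lambda>n. norm (x - s n)) \<longlonglongrightarrow> norm (x - t)"
      by (intro tendsto_intros t)
    show "(\<lambda>n. d + 1 / real (Suc n)) \<longlonglongrightarrow> d + 0"
      by (intro tendsto_intros LIMSEQ_inverse_real_of_nat[unfolded inverse_eq_divide])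
    show "\<exists>N. \<forall>n\<ge>N. norm (x - s n) \<le> d + 1 / real (Suc n)"
      using s(2) less_imp_le by blast
  qed
  then have xt: "norm (x - t) \<le> d" by simp
  have "inner v (x - t) = 0" if v: "v \<in> S" for v
  proof (cases "v = 0")
    case False
    \<comment> \<open>This \<open>r\<close> minimises the distance from \<open>x - t\<close> to the
      line through \<open>v\<close>; moving along it would beat the nearest point unless
      \<open>inner v (x - t)\<close> is zero.\<close>
    define r where "r = inner v (x - t) / inner v v"
    have "t + r *\<^sub>R v \<in> S"
      by (intro subspace_add subspace_scale S tS v)
    then have "d \<le> norm (x - (t + r *\<^sub>R v))" by (rule d)
    then have "norm (x - t) \<le> norm (x - t - r *\<^sub>R v)"
      using xt by (simp add: diff_diff_eq)
    then have "(norm (x - t))\<^sup>2 \<le> (norm (x - t - r *\<^sub>R v))\<^sup>2"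
      by (intro power_mono) auto
    also have "\<dots> = (norm (x - t))\<^sup>2 - 2 * r * inner v (x - t) + r\<^sup>2 * inner v v"
      unfolding power2_norm_eq_inner
      by (simp add: inner_diff_left inner_diff_right inner_commute power2_eq_square algebra_simps)
    also have "\<dots> = (norm (x - t))\<^sup>2 - (inner v (x - t))\<^sup>2 / inner v v"
      using False by (simp add: r_def power2_eq_square)
    finally have "(inner v (x - t))\<^sup>2 / inner v v \<le> 0" by simp
    moreover have "inner v v > 0" using False by simp
    ultimately show ?thesis
      by (simp add: divide_le_0_iff)
  qed simp
  moreover have "x - t \<noteq> 0" using x tS by auto
  ultimately show thesis by (rule that[rotated])
qed

lemma linear_operatorD:
  assumes "linear_operator A"
  shows "(u, f) \<in> A \<Longrightarrow> (v, g) \<in> A \<Longrightarrow> (u + v, f + g) \<in> A"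
    and "(u, f) \<in> A \<Longrightarrow> (c *\<^sub>C u, c *\<^sub>C f) \<in> A"
    and "(0, 0) \<in> A"
    and "(u, f) \<in> A \<Longrightarrow> (u, g) \<in> A \<Longrightarrow> f = g"
  using assms unfolding linear_operator_def single_valued_def by blast+

lemma linear_operator_diff:
  assumes "linear_operator A" "(u, f) \<in> A" "(v, g) \<in> A"
  shows "(u - v, f - g) \<in> A"
proof -
  have "((-1) *\<^sub>C v, (-1) *\<^sub>C g) \<in> A"
    using linear_operatorD(2)[OF assms(1,3)] .
  then have "(u + (-1) *\<^sub>C v, f + (-1) *\<^sub>C g) \<in> A"
    by (rule linear_operatorD(1)[OF assms(1,2)])
  moreover have "u + (-1) *\<^sub>C v = u - v" "f + (-1) *\<^sub>C g = f - g"
    by (auto intro: ell2_eqI)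
  ultimately show ?thesis by simp
qed

lemma linear_operator_scaleR:
  assumes "linear_operator A" "(u, f) \<in> A"
  shows "(r *\<^sub>R u, r *\<^sub>R f) \<in> A"
  unfolding scaleR_ell2_def by (rule linear_operatorD(2)[OF assms])

text \<open>The lower bound makes \<open>A - z\<close> injective with closed range, since
  \<open>A\<close> is closed; a trivial orthogonal complement makes the range everything. The
  inverse then has norm at most \<open>1 / \<delta>\<close>.\<close>

lemma
  assumes A: "linear_operator A" "closed A"
    and \<delta>: "\<delta> > 0" and bound: "\<And>u f. (u, f) \<in> A \<Longrightarrow> \<delta> * norm u \<le> norm (f - z *\<^sub>C u)"
    and triv: "\<And>g. (\<And>u f. (u, f) \<in> A \<Longrightarrow> cinner (f - z *\<^sub>C u) g = 0) \<Longrightarrow> g = 0"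
  shows range_eq_UNIV: "\<exists>u f. (u, f) \<in> A \<and> g = f - z *\<^sub>C u"
    and resolvent_setI: "z \<in> resolvent_set A"
proof -
  define S where "S = {f - z *\<^sub>C u | u f. (u, f) \<in> A}"
  have add: "(f - z *\<^sub>C u) + (g - z *\<^sub>C v) = (f + g) - z *\<^sub>C (u + v)"
    and scale: "c *\<^sub>C (f - z *\<^sub>C u) = c *\<^sub>C f - z *\<^sub>C (c *\<^sub>C u)" for c f g u v
    by (auto intro!: ell2_eqI simp: algebra_simps)
  have S_add: "s \<in> S \<Longrightarrow> t \<in> S \<Longrightarrow> s + t \<in> S"
    and S_scale: "s \<in> S \<Longrightarrow> c *\<^sub>C s \<in> S" for s t c
  proof -
    assume "s \<in> S" "t \<in> S"
    then obtain u f v g where "(u, f) \<in> A" "s = f - z *\<^sub>C u" "(v, g) \<in> A" "t = g - z *\<^sub>C v"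
      unfolding S_def by blast
    then show "s + t \<in> S"
      using linear_operatorD(1)[OF A(1)] unfolding S_def by (simp only: add) blast
  next
    assume "s \<in> S"
    then obtain u f where "(u, f) \<in> A" "s = f - z *\<^sub>C u"
      unfolding S_def by blast
    then show "c *\<^sub>C s \<in> S"
      using linear_operatorD(2)[OF A(1)] unfolding S_def by (simp only: scale) blast
  qed
  have S_0: "0 \<in> S"
    unfolding S_def using linear_operatorD(3)[OF A(1)] by (auto intro!: exI[of _ 0] ell2_eqI)
  have "subspace S"
    unfolding subspace_def scaleR_ell2_def by (auto intro: S_add S_scale S_0)
  moreover have "closed S"
    unfolding closed_sequential_limits
  proof (intro allI impI, elim conjE)
    fix g l assume g: "\<forall>n. g n \<in> S" "g \<longlonglongrightarrow> l"
    then have "\<exists>u f. (u, f) \<in> A \<and> g n = f - z *\<^sub>C u" for n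
      unfolding S_def by blast
    then obtain u f where uf: "\<And>n. (u n, f n) \<in> A" "\<And>n. g n = f n - z *\<^sub>C u n"
      by metis
    \<comment> \<open>The lower bound carries the Cauchy property from the images \<open>g n\<close>
      back to the arguments \<open>u n\<close>.\<close>
    have "Cauchy u"
    proof (rule metric_CauchyI)
      fix e :: real assume e: "e > 0"
      with \<delta> have "\<delta> * e > 0" by simp
      then obtain N where N: "\<And>m n. m \<ge> N \<Longrightarrow> n \<ge> N \<Longrightarrow> dist (g m) (g n) < \<delta> * e"
        using LIMSEQ_imp_Cauchy[OF g(2)] unfolding Cauchy_def by metis
      have "dist (u m) (u n) < e" if "m \<ge> N" "n \<ge> N" for m n
      proof -
        have "\<delta> * norm (u m - u n) \<le> norm ((f m - f n) - z *\<^sub>C (u m - u n))"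
          by (intro bound linear_operator_diff A uf)
        also have "(f m - f n) - z *\<^sub>C (u m - u n) = g m - g n"
          unfolding uf by (auto intro!: ell2_eqI simp: algebra_simps)
        also have "norm \<dots> < \<delta> * e"
          using N[OF that] by (simp add: dist_norm)
        finally show ?thesis
          using \<delta> by (simp add: dist_norm)
      qed
      then show "\<exists>N. \<forall>m\<ge>N. \<forall>n\<ge>N. dist (u m) (u n) < e" by blast
    qed
    then obtain v where v: "u \<longlonglongrightarrow> v"
      using Cauchy_convergent convergent_def by blast
    have "(\<lambda>n. g n + z *\<^sub>C u n) \<longlonglongrightarrow> l + z *\<^sub>C v"
      by (intro tendsto_intros tendsto_scaleC g v)
    then have "f \<longlonglongrightarrow> l + z *\<^sub>C v"
      unfolding uf by simp
    then have "(v, l + z *\<^sub>C v) \<in> A"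
      using closed_sequentially[OF A(2), of "\<lambda>n. (u n, f n)"] uf(1) v tendsto_Pair by blast
    then show "l \<in> S"
      unfolding S_def by force
  qed
  moreover have "g = 0" if "\<And>s. s \<in> S \<Longrightarrow> inner s g = 0" for g
  proof (rule triv)
    fix u f assume "(u, f) \<in> A"
    then have s: "f - z *\<^sub>C u \<in> S" unfolding S_def by blast
    \<comment> \<open>\<open>S\<close> is invariant under multiplication by \<open>-\<i>\<close>, so
      real orthogonality to \<open>S\<close> already gives complex orthogonality.\<close>
    show "cinner (f - z *\<^sub>C u) g = 0"
      unfolding cinner_eq using that[OF s] that[OF S_scale[OF s]] by (simp add: Complex_eq_0)
  qed
  ultimately have UNIV: "S = UNIV"
    using exists_orthogonal_vector by metis
  then show ex: "\<exists>u f. (u, f) \<in> A \<and> g = f - z *\<^sub>C u" for g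
    unfolding S_def by blast
  then obtain R F where RF: "\<And>g. (R g, F g) \<in> A" "\<And>g. g = F g - z *\<^sub>C R g"
    by metis
  have uniq: "u = R (f - z *\<^sub>C u)" if "(u, f) \<in> A" for u f
  proof -
    let ?g = "f - z *\<^sub>C u"
    have "\<delta> * norm (u - R ?g) \<le> norm ((f - F ?g) - z *\<^sub>C (u - R ?g))"
      by (intro bound linear_operator_diff A that RF)
    also have "(f - F ?g) - z *\<^sub>C (u - R ?g) = ?g - (F ?g - z *\<^sub>C R ?g)"
      by (auto intro!: ell2_eqI simp: algebra_simps)
    also have "\<dots> = 0"
      using RF(2)[of ?g] by simp
    finally show ?thesis
      using \<delta> by (simp add: mult_le_0_iff)
  qed
  have "bounded_linear R"
  proof (rule bounded_linear_intro[where K = "1 / \<delta>"])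
    fix g h r
    have "R g + R h = R ((F g + F h) - z *\<^sub>C (R g + R h))"
      by (intro uniq linear_operatorD(1)[OF A(1)] RF)
    then show "R (g + h) = R g + R h"
      using RF(2)[of g] RF(2)[of h] by (simp only: add[symmetric])
    have "r *\<^sub>R R g = R (r *\<^sub>R F g - z *\<^sub>C (r *\<^sub>R R g))"
      by (intro uniq linear_operator_scaleR A RF)
    then show "R (r *\<^sub>R g) = r *\<^sub>R R g"
      using RF(2)[of g] unfolding scaleR_ell2_def by (simp only: scale[symmetric])
    show "norm (R g) \<le> norm g * (1 / \<delta>)"
      using bound[OF RF(1)[of g]] RF(2)[of g] \<delta> by (simp add: field_simps)
  qed
  moreover have "{(f - z *\<^sub>C u, u) | u f. (u, f) \<in> A} = {(g, R g) | g. True}"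
  proof (intro equalityI subsetI)
    fix x assume "x \<in> {(f - z *\<^sub>C u, u) | u f. (u, f) \<in> A}"
    then show "x \<in> {(g, R g) | g. True}" using uniq by auto
  next
    fix x assume "x \<in> {(g, R g) | g. True}"
    then obtain g where "x = (F g - z *\<^sub>C R g, R g)" using RF(2) by force
    then show "x \<in> {(f - z *\<^sub>C u, u) | u f. (u, f) \<in> A}" using RF(1) by blast
  qed
  ultimately show "z \<in> resolvent_set A"
    unfolding resolvent_set_def by blast
qed

subsection \<open>Adjoints and closures\<close>

lemma closed_adjoint_operator: "closed (adjoint_operator A)"
proof -
  have "adjoint_operator A = (\<Inter>(u, f)\<in>A. {x. cinner f (fst x) = cinner u (snd x)})"
    by (auto simp: adjoint_operator_def)
  also have "closed \<dots>"
    by (auto intro!: closed_INT closed_Collect_eq continuous_intros)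
  finally show ?thesis .
qed

lemma adjoint_operator_antimono: "A \<subseteq> B \<Longrightarrow> adjoint_operator B \<subseteq> adjoint_operator A"
  by (auto simp: adjoint_operator_def)

text \<open>For a fixed pair \<open>(v, g)\<close> the defining relation of the adjoint is a closed
  condition on the graph, so it survives taking limits.\<close>

lemma adjoint_operator_closure: "adjoint_operator (closure A) = adjoint_operator A"
proof (rule equalityI[OF adjoint_operator_antimono[OF closure_subset]], rule subsetI)
  fix x assume x: "x \<in> adjoint_operator A"
  obtain v g where [simp]: "x = (v, g)" by force
  have "closure A \<subseteq> {y. cinner (snd y) v = cinner (fst y) g}"
    using x by (intro closure_minimal closed_Collect_eq continuous_intros)
      (auto simp: adjoint_operator_def)
  then show "x \<in> adjoint_operator (closure A)"
    by (auto simp: adjoint_operator_def)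
qed

text \<open>Single-valuedness of the closure is closability; the linear structure passes to the
  closure because addition and scaling are continuous.\<close>

lemma linear_operator_closure:
  assumes A: "linear_operator A" and sv: "single_valued (closure A)"
  shows "linear_operator (closure A)"
  unfolding linear_operator_def
proof (intro conjI allI impI sv)
  show "(0, 0) \<in> closure A"
    using linear_operatorD(3)[OF A] closure_subset by blast
next
  fix u f v g assume "(u, f) \<in> closure A" "(v, g) \<in> closure A"
  moreover have "(\<lambda>(x, y). x + y) ` closure (A \<times> A) \<subseteq> closure A"
  proof (rule image_closure_subset[OF _ closed_closure])
    show "continuous_on (closure (A \<times> A)) (\<lambda>(x, y). x + y)"
      unfolding case_prod_beta by (intro continuous_intros)
    have "x + y \<in> A" if "x \<in> A" "y \<in> A" for x y
      using linear_operatorD(1)[OF A, of "fst x" "snd x" "fst y" "snd y"] that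
      by (simp add: plus_prod_def)
    then show "(\<lambda>(x, y). x + y) ` (A \<times> A) \<subseteq> closure A"
      using closure_subset by fastforce
  qed
  ultimately have "(\<lambda>(x, y). x + y) ((u, f), (v, g)) \<in> closure A"
    unfolding closure_Times by blast
  then show "(u + v, f + g) \<in> closure A" by simp
next
  fix c u f assume "(u, f) \<in> closure A"
  moreover have "(\<lambda>x. (c *\<^sub>C fst x, c *\<^sub>C snd x)) ` closure A \<subseteq> closure A"
  proof (rule image_closure_subset[OF _ closed_closure])
    show "continuous_on (closure A) (\<lambda>x. (c *\<^sub>C fst x, c *\<^sub>C snd x))"
      by (intro continuous_intros bounded_linear.continuous_on[OF bounded_linear_scaleC])
    have "(c *\<^sub>C fst x, c *\<^sub>C snd x) \<in> A" if "x \<in> A" for x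
      using linear_operatorD(2)[OF A, of "fst x" "snd x"] that by simp
    then show "(\<lambda>x. (c *\<^sub>C fst x, c *\<^sub>C snd x)) ` A \<subseteq> closure A"
      using closure_subset by blast
  qed
  ultimately show "(c *\<^sub>C u, c *\<^sub>C f) \<in> closure A"
    by force
qed

lemma closure_subspace:
  fixes S :: "'a :: real_normed_vector set"
  assumes "subspace S"
  shows "subspace (closure S)"
  unfolding subspace_def
proof (intro conjI ballI allI)
  show "0 \<in> closure S"
    using subspace_0[OF assms] closure_subset by blast
next
  fix x y assume "x \<in> closure S" "y \<in> closure S"
  moreover have "(\<lambda>(x, y). x + y) ` closure (S \<times> S) \<subseteq> closure S"
  proof (rule image_closure_subset[OF _ closed_closure])
    show "continuous_on (closure (S \<times> S)) (\<lambda>(x, y). x + y)"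
      unfolding case_prod_beta by (intro continuous_intros)
    show "(\<lambda>(x, y). x + y) ` (S \<times> S) \<subseteq> closure S"
      using subspace_add[OF assms] closure_subset by fastforce
  qed
  ultimately have "(\<lambda>(x, y). x + y) (x, y) \<in> closure S"
    unfolding closure_Times by blast
  then show "x + y \<in> closure S" by simp
next
  fix c :: real and x assume "x \<in> closure S"
  moreover have "(*\<^sub>R) c ` closure S \<subseteq> closure S"
    by (rule image_closure_subset[OF _ closed_closure])
      (use subspace_scale[OF assms] closure_subset in \<open>auto intro!: continuous_intros\<close>)
  ultimately show "c *\<^sub>R x \<in> closure S" by blast
qed

subsection \<open>Minimal and maximal Jacobi operators\<close>

text \<open>Acts on arbitrary sequences, so that solutions of the recurrence can be studied before
  they are known to be square summable.\<close>

definition jac :: "(nat \<Rightarrow> real) \<Rightarrow> (nat \<Rightarrow> real) \<Rightarrow> (nat \<Rightarrow> complex) \<Rightarrow> nat \<Rightarrow> complex" where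
  "jac a b x n = (if n = 0 then 0 else complex_of_real (a (n - 1)) * x (n - 1))
     + complex_of_real (b n) * x n + complex_of_real (a n) * x (n + 1)"

definition jacobi_max :: "(nat \<Rightarrow> real) \<Rightarrow> (nat \<Rightarrow> real) \<Rightarrow> operator" where
  "jacobi_max a b = {(u, f). \<forall>n. coord f n = jac a b (coord u) n}"

lemma jacobi_min_eq: "jacobi_min a b = {(u, f). finite {n. coord u n \<noteq> 0}} \<inter> jacobi_max a b"
  by (auto simp: jacobi_min_def jacobi_max_def jac_def)

lemma jacobi_min_subset_max: "jacobi_min a b \<subseteq> jacobi_max a b"
  by (simp add: jacobi_min_eq)

lemma jac_add: "jac a b (\<lambda>n. x n + y n) n = jac a b x n + jac a b y n"
  and jac_scale: "jac a b (\<lambda>n. c * x n) n = c * jac a b x n"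
  by (simp_all add: jac_def algebra_simps)

lemma linear_jacobi_max: "linear_operator (jacobi_max a b)"
  unfolding linear_operator_def single_valued_def
  by (auto simp: jacobi_max_def intro!: ell2_eqI) (simp_all add: jac_def algebra_simps)

lemma linear_jacobi_min: "linear_operator (jacobi_min a b)"
proof -
  have "finite {n. coord (u + v) n \<noteq> 0}" if "finite {n. coord u n \<noteq> 0}" "finite {n. coord v n \<noteq> 0}" for u v
    by (rule finite_subset[OF _ finite_UnI[OF that]]) auto
  moreover have "finite {n. coord (c *\<^sub>C u) n \<noteq> 0}" if "finite {n. coord u n \<noteq> 0}" for c u
    by (rule finite_subset[OF _ that]) auto
  ultimately show ?thesis
    using linear_jacobi_max[of a b]
    unfolding linear_operator_def jacobi_min_eq single_valued_def by auto
qed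

text \<open>The discrete Lagrange identity: interior terms telescope, and only the Wronskian at
  \<open>M\<close> remains.\<close>

lemma green_identity:
  "(\<Sum>n<Suc M. jac a b x n * cnj (y n) - x n * cnj (jac a b y n))
     = complex_of_real (a M) * (x (Suc M) * cnj (y M) - x M * cnj (y (Suc M)))"
proof (induction M)
  case (Suc M)
  then show ?case
    by (subst sum.lessThan_Suc) (simp add: jac_def algebra_simps)
qed (simp add: jac_def algebra_simps)

lemma cinner_finite: "(\<And>n. n \<ge> M \<Longrightarrow> coord u n = 0) \<Longrightarrow> cinner u v = (\<Sum>n<M. coord u n * cnj (coord v n))"
  unfolding cinner_def by (intro suminf_finite) auto

text \<open>A finitely supported \<open>u\<close> kills the boundary term in
  \<open>green_identity\<close>, so the operator can be moved onto any \<open>v\<close>, even if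
  \<open>jac a b (coord v)\<close> is not square summable.\<close>

lemma cinner_jacobi_min:
  assumes "(u, f) \<in> jacobi_min a b"
  shows "\<exists>M. cinner f v = (\<Sum>n<M. coord u n * cnj (jac a b (coord v) n)) \<and> (\<forall>n\<ge>M. coord u n = 0)"
proof -
  from assms have "finite {n. coord u n \<noteq> 0}" and f: "\<And>n. coord f n = jac a b (coord u) n"
    by (auto simp: jacobi_min_eq jacobi_max_def)
  then obtain N where N: "\<And>n. coord u n \<noteq> 0 \<Longrightarrow> n < N"
    by (auto simp: finite_nat_set_iff_bounded)
  then have u0: "coord u n = 0" if "n \<ge> N" for n
    using that not_less by blast
  have "cinner f v = (\<Sum>n<Suc N. jac a b (coord u) n * cnj (coord v n))"
    unfolding f[symmetric] by (rule cinner_finite) (auto simp: f jac_def u0)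
  also have "\<dots> = (\<Sum>n<Suc N. coord u n * cnj (jac a b (coord v) n))"
    using green_identity[of a b "coord u" "coord v" N] by (simp add: sum_subtractf u0 del: sum.lessThan_Suc)
  finally show ?thesis
    using u0 by (auto intro!: exI[of _ "Suc N"])
qed

lemma unit_vector: "\<exists>u. coord u = (\<lambda>n. if n = m then 1 else 0)"
proof -
  have "summable (\<lambda>n. (cmod (if n = m then 1 else 0))\<^sup>2)"
    by (intro summable_finite[of "{m}"]) auto
  then show ?thesis
    by (intro exI[of _ "Abs_ell2 (\<lambda>n. if n = m then 1 else 0)"]) (simp add: Abs_ell2_inverse)
qed

text \<open>Testing against unit vectors recovers \<open>g\<close> coordinate by coordinate; the
  converse is the Green identity without boundary term.\<close>

lemma adjoint_jacobi_min: "adjoint_operator (jacobi_min a b) = jacobi_max a b"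
proof (intro equalityI subrelI)
  fix v g assume vg: "(v, g) \<in> adjoint_operator (jacobi_min a b)"
  have "coord g m = jac a b (coord v) m" for m
  proof -
    obtain u where u: "coord u = (\<lambda>n. if n = m then 1 else 0)"
      using unit_vector by blast
    then have "u \<in> Domain (jacobi_min a b)"
      by (simp add: Domain_jacobi_min)
    then obtain f where f: "(u, f) \<in> jacobi_min a b" by blast
    obtain M where M: "cinner f v = (\<Sum>n<M. coord u n * cnj (jac a b (coord v) n))"
      and M': "\<forall>n\<ge>M. coord u n = 0"
      using cinner_jacobi_min[OF f] by blast
    then have "m < M"
      by (metis u not_less zero_neq_one)
    have pick: "(\<Sum>n<M. coord u n * h n) = h m" for h
    proof -
      have "(\<Sum>n<M. coord u n * h n) = (\<Sum>n<M. if n = m then h n else 0)"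
        by (intro sum.cong) (auto simp: u)
      then show ?thesis using \<open>m < M\<close> by simp
    qed
    have "cinner f v = cinner u g"
      using vg f by (auto simp: adjoint_operator_def)
    also have "cinner u g = (\<Sum>n<M. coord u n * cnj (coord g n))"
      using M' by (intro cinner_finite) auto
    finally show ?thesis
      unfolding M pick by simp
  qed
  then show "(v, g) \<in> jacobi_max a b" by (simp add: jacobi_max_def)
next
  fix v g assume vg: "(v, g) \<in> jacobi_max a b"
  have "cinner f v = cinner u g" if uf: "(u, f) \<in> jacobi_min a b" for u f
  proof -
    obtain M where M: "cinner f v = (\<Sum>n<M. coord u n * cnj (jac a b (coord v) n))"
      and M': "\<forall>n\<ge>M. coord u n = 0"
      using cinner_jacobi_min[OF uf] by blast
    have "cinner u g = (\<Sum>n<M. coord u n * cnj (coord g n))"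
      using M' by (intro cinner_finite) auto
    with M vg show ?thesis by (simp add: jacobi_max_def)
  qed
  then show "(v, g) \<in> adjoint_operator (jacobi_min a b)"
    by (auto simp: adjoint_operator_def)
qed

lemma densely_defined_jacobi_min: "densely_defined (jacobi_min a b)"
proof (rule ccontr)
  let ?D = "Domain (jacobi_min a b)"
  assume "\<not> ?thesis"
  then have "closure ?D \<noteq> UNIV" by (simp add: densely_defined_def)
  moreover have "subspace ?D"
    unfolding subspace_def
    using linear_operatorD(1,3)[OF linear_jacobi_min] linear_operator_scaleR[OF linear_jacobi_min]
    by blast
  ultimately obtain g where g: "g \<noteq> 0" "\<And>s. s \<in> closure ?D \<Longrightarrow> inner s g = 0"
    using exists_orthogonal_vector[of "closure ?D"] closure_subspace by blast
  have "coord g m = 0" for m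
  proof -
    obtain u where u: "coord u = (\<lambda>n. if n = m then 1 else 0)"
      using unit_vector by blast
    \<comment> \<open>Scaling the unit vector by \<open>coord g m\<close> makes its product with
      \<open>g\<close> the square of a modulus, so real orthogonality suffices.\<close>
    have "coord g m *\<^sub>C u \<in> ?D"
      by (auto simp: Domain_jacobi_min u intro!: finite_subset[of _ "{m}"])
    then have "inner (coord g m *\<^sub>C u) g = 0"
      using g(2) closure_subset by blast
    moreover have "cinner (coord g m *\<^sub>C u) g = (\<Sum>n<Suc m. coord (coord g m *\<^sub>C u) n * cnj (coord g n))"
      by (rule cinner_finite) (simp add: u)
    then have "cinner (coord g m *\<^sub>C u) g = complex_of_real ((cmod (coord g m))\<^sup>2)"
      unfolding complex_norm_square by (simp add: u)
    ultimately show ?thesis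
      by (simp add: inner_ell2_def)
  qed
  then have "g = 0" by (intro ell2_eqI) simp
  with g show False by simp
qed

section \<open>Solutions of the recurrence and simple eigenvalues\<close>

text \<open>Since no \<open>a n\<close> vanishes, the three-term recurrence determines
  \<open>x (n + 1)\<close> from the preceding values.\<close>

lemma jacobi_solution_unique:
  assumes a: "\<And>n. a n \<noteq> 0"
    and x: "\<And>n. jac a b x n = z * x n" and x0: "x 0 = 0"
  shows "x n = 0"
proof (induction n rule: less_induct)
  case (less n)
  show ?case
  proof (cases n)
    case (Suc m)
    have "complex_of_real (a m) * x (Suc m) = 0"
      using x[of m] less[of m] less[of "m - 1"] Suc by (auto simp: jac_def split: if_splits)
    with a Suc show ?thesis by simp
  qed (use x0 in simp)
qed

lemma cdim_span_singleton: "u \<noteq> 0 \<Longrightarrow> cdim (complex_ell2.span {u}) = 1"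
proof -
  assume "u \<noteq> 0"
  then have "complex_ell2.independent {u}" by simp
  then have "complex_ell2.dim (complex_ell2.span {u}) = card {u}"
    by (intro complex_ell2.dim_span_eq_card_independent)
  then show ?thesis
    unfolding cdim_def one_enat_def by (auto intro!: exI[of _ "{u}"])
qed

text \<open>By uniqueness an eigenvector is determined by its value at \<open>0\<close>, so any
  other one is a multiple of \<open>u\<close>.\<close>

lemma cdim_eigenspace:
  assumes a: "\<And>n. a n \<noteq> 0" and A: "linear_operator A" "A \<subseteq> jacobi_max a b"
    and u: "u \<in> eigenspace A z" "u \<noteq> 0"
  shows "cdim (eigenspace A z) = 1"
proof -
  have eig: "jac a b (coord v) n = z * coord v n" if "v \<in> eigenspace A z" for v n
  proof -
    have "(v, z *\<^sub>C v) \<in> jacobi_max a b"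
      using that A(2) by (auto simp: eigenspace_def)
    then have "coord (z *\<^sub>C v) n = jac a b (coord v) n"
      unfolding jacobi_max_def by blast
    then show ?thesis by simp
  qed
  have u0: "coord u 0 \<noteq> 0"
  proof
    assume "coord u 0 = 0"
    then have "coord u n = 0" for n
      by (rule jacobi_solution_unique[OF a eig[OF u(1)]])
    with u(2) show False by (metis coord_zero ell2_eqI)
  qed
  have "v \<in> complex_ell2.span {u}" if v: "v \<in> eigenspace A z" for v
  proof -
    define c where "c = - coord v 0 / coord u 0"
    have "coord v n + c * coord u n = 0" for n
    proof (rule jacobi_solution_unique[where a = a and b = b and z = z, OF a])
      show "jac a b (\<lambda>n. coord v n + c * coord u n) n = z * (coord v n + c * coord u n)" for n
        unfolding jac_add jac_scale eig[OF v] eig[OF u(1)] by (simp add: algebra_simps)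
      show "coord v 0 + c * coord u 0 = 0"
        using u0 by (simp add: c_def)
    qed
    then have "v = (- c) *\<^sub>C u"
      by (intro ell2_eqI) (metis add_eq_0_iff2 coord_scaleC mult_minus_left)
    then show ?thesis
      by (metis complex_ell2.span_base complex_ell2.span_scale singletonI)
  qed
  moreover have "c *\<^sub>C u \<in> eigenspace A z" for c
    using linear_operatorD(2)[OF A(1), of u "z *\<^sub>C u" c] u(1)
    by (simp add: eigenspace_def mult.commute)
  ultimately have "eigenspace A z = complex_ell2.span {u}"
    unfolding complex_ell2.span_singleton by blast
  then show ?thesis
    using cdim_span_singleton[OF u(2)] by simp
qed

subsection \<open>Discreteness of the spectrum\<close>

text \<open>Taking adjoints reverses the inclusion, \<open>A\<close> is its own adjoint, and the
  adjoint of the minimal operator is the maximal one.\<close>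

lemma self_adjoint_subset_jacobi_max:
  assumes "self_adjoint A" "jacobi_min a b \<subseteq> A"
  shows "A \<subseteq> jacobi_max a b"
  using adjoint_operator_antimono[OF assms(2)] assms(1)
  by (simp add: adjoint_jacobi_min self_adjoint_def)

lemma self_adjoint_symmetric:
  "self_adjoint A \<Longrightarrow> (u, f) \<in> A \<Longrightarrow> (v, g) \<in> A \<Longrightarrow> cinner f v = cinner u g"
  unfolding self_adjoint_def adjoint_operator_def by blast

lemma cinner_scaleC_right: "cinner u (c *\<^sub>C v) = cnj c * cinner u v"
  by (metis cinner_commute cinner_scaleC_left complex_cnj_mult)

lemma cinner_diff_left: "cinner (u - v) w = cinner u w - cinner v w"
  using cinner_add_left[of "u - v" v w] by simp

lemma cinner_self_eq_0: "cinner u u = 0 \<Longrightarrow> u = 0"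
  by (metis inner_ell2_def inner_eq_zero_iff zero_complex.sel(1))

lemma cinner_self_norm: "cinner u u = complex_of_real ((norm u)\<^sup>2)"
  by (simp add: cinner_self norm_ell2_sq)

lemma self_adjoint_eigenvalue_real:
  assumes "self_adjoint A" "u \<in> eigenspace A z" "u \<noteq> 0"
  shows "cnj z = z"
proof -
  have "z * cinner u u = cnj z * cinner u u"
    using self_adjoint_symmetric[OF assms(1), of u "z *\<^sub>C u" u "z *\<^sub>C u"] assms(2)
    by (simp add: eigenspace_def cinner_scaleC_left cinner_scaleC_right)
  with cinner_self_eq_0[of u] assms(3) show ?thesis by auto
qed

text \<open>Compactness turns approximate eigenvectors into true ones. A point that is no eigenvalue
  therefore has a lower bound for \<open>A - z\<close> and is regular, and an accumulation point of
  the spectrum would yield a unit eigenvector orthogonal to itself.\<close>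

lemma discrete_spectrumI:
  assumes a: "\<And>n. a n \<noteq> 0" and A: "self_adjoint A" "jacobi_min a b \<subseteq> A"
    and compact: "\<And>(u :: nat \<Rightarrow> ell2) f K. (\<And>k. (u k, f k) \<in> A) \<Longrightarrow> (\<And>k. norm (u k) \<le> K) \<Longrightarrow> (\<And>k. norm (f k) \<le> K)
      \<Longrightarrow> \<exists>\<phi> L. strict_mono \<phi> \<and> (\<lambda>k. u (\<phi> k)) \<longlonglongrightarrow> L"
  shows "discrete_spectrum A"
    and "\<And>z. z \<in> spectrum A \<Longrightarrow> \<exists>u\<in>eigenspace A z. u \<noteq> 0"
proof -
  have lin: "linear_operator A" and cl: "closed A"
    using A(1) closed_adjoint_operator[of A] by (auto simp: self_adjoint_def)
  \<comment> \<open>Normalised approximate eigenvectors at \<open>z\<close> accumulate at a unit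
    eigenvector, because \<open>A\<close> is closed.\<close>
  have limit: "\<exists>\<phi> u. strict_mono \<phi> \<and> (\<lambda>k. v (\<phi> k)) \<longlonglongrightarrow> u \<and> norm u = 1 \<and> u \<in> eigenspace A z"
    if v: "\<And>k. (v k, g k) \<in> A" "\<And>k. norm (v k) = 1"
      and lim: "(\<lambda>k. g k - z *\<^sub>C v k) \<longlonglongrightarrow> 0" for v g :: "nat \<Rightarrow> ell2" and z
  proof -
    obtain K where K: "\<And>k. norm (g k - z *\<^sub>C v k) \<le> K"
      using convergent_imp_Bseq[OF convergentI[OF lim]] unfolding Bseq_def by blast
    have "K \<ge> 0" using K[of 0] norm_ge_zero order_trans by blast
    have "norm (g k) \<le> K + cmod z + 1" for k
      using norm_triangle_ineq[of "g k - z *\<^sub>C v k" "z *\<^sub>C v k"] K[of k] v(2)[of k]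
      by (simp add: norm_scaleC)
    moreover have "norm (v k) \<le> K + cmod z + 1" for k
      using v(2) \<open>K \<ge> 0\<close> by simp
    ultimately obtain \<phi> u where \<phi>: "strict_mono \<phi>" "(\<lambda>k. v (\<phi> k)) \<longlonglongrightarrow> u"
      using compact[of v g "K + cmod z + 1", OF v(1)] by blast
    have "(\<lambda>k. norm (v (\<phi> k))) \<longlonglongrightarrow> norm u"
      by (intro tendsto_norm \<phi>)
    then have "norm u = 1"
      by (simp add: v(2) LIMSEQ_const_iff)
    have "(\<lambda>k. (g (\<phi> k) - z *\<^sub>C v (\<phi> k)) + z *\<^sub>C v (\<phi> k)) \<longlonglongrightarrow> 0 + z *\<^sub>C u"
      using LIMSEQ_subseq_LIMSEQ[OF lim \<phi>(1)]
      by (intro tendsto_add tendsto_scaleC \<phi>) (simp add: o_def)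
    then have "(\<lambda>k. g (\<phi> k)) \<longlonglongrightarrow> z *\<^sub>C u" by simp
    then have "(u, z *\<^sub>C u) \<in> A"
      using closed_sequentially[OF cl, of "\<lambda>k. (v (\<phi> k), g (\<phi> k))"] v(1) \<phi>(2) tendsto_Pair by blast
    then show ?thesis
      using \<phi> \<open>norm u = 1\<close> by (auto simp: eigenspace_def)
  qed
  show eig: "\<exists>u\<in>eigenspace A z. u \<noteq> 0" if z: "z \<in> spectrum A" for z
  proof (rule ccontr)
    assume "\<not> ?thesis"
    then have triv: "\<And>u. u \<in> eigenspace A z \<Longrightarrow> u = 0" by blast
    \<comment> \<open>Without such a \<open>\<delta>\<close> there would be unit vectors with
      \<open>f - z *\<^sub>C u\<close> tending to zero, hence an eigenvector at
      \<open>z\<close>.\<close>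
    have "\<exists>\<delta>>0. \<forall>(u, f)\<in>A. \<delta> * norm u \<le> norm (f - z *\<^sub>C u)"
    proof (rule ccontr)
      assume neg: "\<not> ?thesis"
      have "\<exists>u f. (u, f) \<in> A \<and> norm u = 1 \<and> norm (f - z *\<^sub>C u) < 1 / real (Suc k)" for k
      proof -
        have "1 / real (Suc k) > 0" by simp
        then obtain u f where uf: "(u, f) \<in> A" "norm (f - z *\<^sub>C u) < 1 / real (Suc k) * norm u"
          using neg not_le by blast
        then have u: "norm u > 0"
          by (metis less_le_not_le mult_zero_right norm_ge_zero order_less_le order_trans)
        let ?c = "inverse (norm u)"
        have "(?c *\<^sub>R u, ?c *\<^sub>R f) \<in> A"
          by (rule linear_operator_scaleR[OF lin uf(1)])
        moreover have "norm (?c *\<^sub>R u) = 1" using u by simp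
        moreover have "norm (?c *\<^sub>R f - z *\<^sub>C (?c *\<^sub>R u)) < 1 / real (Suc k)"
        proof -
          have "?c *\<^sub>R f - z *\<^sub>C (?c *\<^sub>R u) = ?c *\<^sub>R (f - z *\<^sub>C u)"
            by (auto intro!: ell2_eqI simp: algebra_simps)
          then have "norm (?c *\<^sub>R f - z *\<^sub>C (?c *\<^sub>R u)) = norm (f - z *\<^sub>C u) / norm u"
            by (simp add: divide_inverse mult.commute)
          also have "\<dots> < 1 / real (Suc k)"
            using uf(2) u by (simp only: pos_divide_less_eq)
          finally show ?thesis .
        qed
        ultimately show ?thesis by blast
      qed
      then obtain v g where vg: "\<And>k. (v k, g k) \<in> A" "\<And>k. norm (v k) = 1"
        "\<And>k. norm (g k - z *\<^sub>C v k) < 1 / real (Suc k)"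
        by metis
      have "(\<lambda>k. g k - z *\<^sub>C v k) \<longlonglongrightarrow> 0"
        by (rule Lim_null_comparison[OF _ LIMSEQ_inverse_real_of_nat])
          (use vg(3) in \<open>auto simp: inverse_eq_divide less_imp_le\<close>)
      then obtain u where "norm u = 1" "u \<in> eigenspace A z"
        using limit[of v g, OF vg(1,2)] by blast
      with triv show False by force
    qed
    then obtain \<delta> where "\<delta> > 0" and \<delta>: "\<And>u f. (u, f) \<in> A \<Longrightarrow> \<delta> * norm u \<le> norm (f - z *\<^sub>C u)"
      by blast
    have "z \<in> resolvent_set A"
    proof (rule resolvent_setI[OF lin cl \<open>\<delta> > 0\<close> \<delta>])
      fix g assume g: "\<And>u f. (u, f) \<in> A \<Longrightarrow> cinner (f - z *\<^sub>C u) g = 0"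
      \<comment> \<open>A vector orthogonal to the range of \<open>A - z\<close> is an eigenvector
        of \<open>A\<close> at \<open>cnj z\<close>; eigenvalues are real, so it would be one at
        \<open>z\<close>.\<close>
      then have "(g, cnj z *\<^sub>C g) \<in> adjoint_operator A"
        by (auto simp: adjoint_operator_def cinner_diff_left cinner_scaleC_left cinner_scaleC_right)
      then have g': "g \<in> eigenspace A (cnj z)"
        using A(1) by (simp add: self_adjoint_def eigenspace_def)
      show "g = 0"
      proof (rule ccontr)
        assume "g \<noteq> 0"
        with self_adjoint_eigenvalue_real[OF A(1) g'] g' triv show False by simp
      qed
    qed
    with z show False by (simp add: spectrum_def)
  qed
  show "discrete_spectrum A"
    unfolding discrete_spectrum_def
  proof (intro ballI conjI)
    fix z assume z: "z \<in> spectrum A"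
    have "cdim (eigenspace A z) = 1"
      using eig[OF z] cdim_eigenspace[OF a lin self_adjoint_subset_jacobi_max[OF A]] by blast
    then show "0 < cdim (eigenspace A z)" "cdim (eigenspace A z) < \<infinity>"
      by (simp_all add: one_enat_def zero_enat_def)
    have "\<not> z islimpt spectrum A"
    proof
      assume "z islimpt spectrum A"
      then obtain \<zeta> where \<zeta>: "\<And>k. \<zeta> k \<in> spectrum A - {z}" "\<zeta> \<longlonglongrightarrow> z"
        unfolding islimpt_sequential by blast
      have "\<exists>v. v \<in> eigenspace A (\<zeta> k) \<and> norm v = 1" for k
      proof -
        obtain u where u: "u \<in> eigenspace A (\<zeta> k)" "u \<noteq> 0"
          using eig \<zeta>(1) by blast
        have "inverse (norm u) *\<^sub>R u \<in> eigenspace A (\<zeta> k)"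
          using linear_operator_scaleR[OF lin, of u "\<zeta> k *\<^sub>C u" "inverse (norm u)"] u(1)
          by (simp add: eigenspace_def scaleR_ell2_def mult.commute)
        with u(2) show ?thesis by (intro exI[of _ "inverse (norm u) *\<^sub>R u"]) simp
      qed
      then obtain v where v: "\<And>k. v k \<in> eigenspace A (\<zeta> k)" "\<And>k. norm (v k) = 1"
        by metis
      \<comment> \<open>Unit eigenvectors at points \<open>\<zeta> k\<close> tending to
        \<open>z\<close> are approximate eigenvectors at \<open>z\<close>.\<close>
      have "(\<lambda>k. norm ((\<zeta> k) *\<^sub>C v k - z *\<^sub>C v k)) \<longlonglongrightarrow> 0"
      proof -
        have "(\<zeta> k) *\<^sub>C v k - z *\<^sub>C v k = (\<zeta> k - z) *\<^sub>C v k" for k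
          by (simp add: complex_ell2.scale_left_diff_distrib)
        then have "norm ((\<zeta> k) *\<^sub>C v k - z *\<^sub>C v k) = norm (\<zeta> k - z)" for k
          by (simp add: norm_scaleC v(2))
        then show ?thesis
          using \<zeta>(2) by (simp add: LIM_zero_iff tendsto_norm_zero_iff)
      qed
      then have "(\<lambda>k. (\<zeta> k) *\<^sub>C v k - z *\<^sub>C v k) \<longlonglongrightarrow> 0"
        by (simp only: tendsto_norm_zero_iff)
      moreover have "(v k, \<zeta> k *\<^sub>C v k) \<in> A" for k
        using v(1)[of k] by (simp add: eigenspace_def)
      ultimately obtain \<phi> u where \<phi>: "(\<lambda>k. v (\<phi> k)) \<longlonglongrightarrow> u" and u: "norm u = 1" "u \<in> eigenspace A z"
        using limit[of v "\<lambda>k. \<zeta> k *\<^sub>C v k" z] v(2) by blast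
      \<comment> \<open>Each \<open>v k\<close> is orthogonal to \<open>u\<close> because their
        eigenvalues differ; in the limit this gives \<open>inner u u = 0\<close>.\<close>
      have orth: "cinner (v k) u = 0" for k
      proof -
        have "cnj z = z"
          using self_adjoint_eigenvalue_real[OF A(1) u(2)] u(1) by force
        then have "\<zeta> k * cinner (v k) u = z * cinner (v k) u"
          using self_adjoint_symmetric[OF A(1), of "v k" "\<zeta> k *\<^sub>C v k" u "z *\<^sub>C u"] v(1)[of k] u(2)
          by (simp add: eigenspace_def cinner_scaleC_left cinner_scaleC_right)
        with \<zeta>(1)[of k] show ?thesis by simp
      qed
      have "(\<lambda>k. inner (v (\<phi> k)) u) \<longlonglongrightarrow> inner u u"
        by (intro tendsto_intros \<phi>)
      then have "inner u u = 0"
        by (simp add: inner_ell2_def orth LIMSEQ_const_iff)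
      with u(1) show False by simp
    qed
    with z show "z isolated_in spectrum A"
      by (simp add: isolated_in_islimpt_iff)
  qed
qed

section \<open>Self-adjointness of the closure\<close>

text \<open>The two conditions make \<open>T - r\<close> onto for the closure \<open>T\<close>. As
  the maximal operator is injective at \<open>r\<close>, it cannot extend \<open>T\<close> properly.
  A single real point \<open>r\<close> thus replaces the usual pair \<open>\<i>\<close>,
  \<open>-\<i>\<close>.\<close>

lemma self_adjoint_closure_jacobi:
  assumes \<delta>: "\<delta> > 0" and bound: "\<And>u f. (u, f) \<in> closure (jacobi_min a b) \<Longrightarrow>
      \<delta> * norm u \<le> norm (f - complex_of_real r *\<^sub>C u)"
    and triv: "\<And>u. u \<in> eigenspace (jacobi_max a b) (complex_of_real r) \<Longrightarrow> u = 0"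
  shows "self_adjoint (closure (jacobi_min a b))"
proof -
  let ?T = "closure (jacobi_min a b)" and ?r = "complex_of_real r"
  have sub: "?T \<subseteq> jacobi_max a b"
    using closed_adjoint_operator[of "jacobi_min a b"]
    by (intro closure_minimal jacobi_min_subset_max) (simp add: adjoint_jacobi_min)
  have lin: "linear_operator ?T"
    using linear_jacobi_max[of a b]
    by (intro linear_operator_closure linear_jacobi_min single_valued_subset[OF sub])
      (simp add: linear_operator_def)
  have adj: "adjoint_operator ?T = jacobi_max a b"
    by (simp add: adjoint_operator_closure adjoint_jacobi_min)
  have onto: "\<exists>u f. (u, f) \<in> ?T \<and> h = f - ?r *\<^sub>C u" for h
  proof (rule range_eq_UNIV[OF lin closed_closure \<delta> bound])
    fix g assume g: "\<And>u f. (u, f) \<in> ?T \<Longrightarrow> cinner (f - ?r *\<^sub>C u) g = 0"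
    then have "(g, ?r *\<^sub>C g) \<in> adjoint_operator ?T"
      by (auto simp: adjoint_operator_def cinner_diff_left cinner_scaleC_left cinner_scaleC_right)
    then show "g = 0"
      unfolding adj by (intro triv) (simp add: eigenspace_def)
  qed
  have "jacobi_max a b \<subseteq> ?T"
  proof (intro subrelI)
    fix v g assume vg: "(v, g) \<in> jacobi_max a b"
    \<comment> \<open>The same right-hand side is solved inside the closure; the difference of the
      two solutions lies in the trivial eigenspace.\<close>
    obtain u f where uf: "(u, f) \<in> ?T" "g - ?r *\<^sub>C v = f - ?r *\<^sub>C u"
      using onto by blast
    have "(v - u, g - f) \<in> jacobi_max a b"
      using linear_operator_diff[OF linear_jacobi_max vg] uf(1) sub by blast
    moreover have gf: "g - f = ?r *\<^sub>C (v - u)"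
      using uf(2) by (simp add: complex_ell2.scale_right_diff_distrib algebra_simps)
    ultimately have "v - u = 0"
      by (intro triv) (simp add: eigenspace_def)
    then show "(v, g) \<in> ?T"
      using uf(1) gf by simp
  qed
  then have "jacobi_max a b = ?T" using sub by blast
  moreover have "densely_defined ?T"
  proof -
    have "closure (Domain (jacobi_min a b)) \<subseteq> closure (Domain ?T)"
      by (intro closure_mono Domain_mono closure_subset)
    then show ?thesis
      using densely_defined_jacobi_min[of a b] by (auto simp: densely_defined_def)
  qed
  ultimately show ?thesis
    using lin adj by (simp add: self_adjoint_def)
qed

subsection \<open>The quadratic form and the semi-bounded case\<close>

text \<open>In terms of \<open>p = twist g u\<close> and \<open>q = flux a g u\<close> the equation \<open>J u = f\<close> is a discrete
  Sturm--Liouville system whose coefficients vary slowly: the factor \<open>(-g)^n\<close> removes the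
  oscillation that the leading terms \<open>b\<^sub>n \<approx> 2 g a\<^sub>n\<close> force upon \<open>u\<close>, and \<open>q\<close> vanishes at \<open>0\<close>
  since \<open>u\<close> is extended by \<open>0\<close> to \<open>n = -1\<close>.\<close>

definition jweight :: "(nat \<Rightarrow> real) \<Rightarrow> (nat \<Rightarrow> real) \<Rightarrow> real \<Rightarrow> nat \<Rightarrow> real" where
  "jweight a b g n = g * b n - a n - (if n = 0 then 0 else a (n - 1))"

definition twist :: "real \<Rightarrow> (nat \<Rightarrow> complex) \<Rightarrow> nat \<Rightarrow> complex" where
  "twist g x n = complex_of_real ((- g) ^ n) * x n"

definition flux :: "(nat \<Rightarrow> real) \<Rightarrow> real \<Rightarrow> (nat \<Rightarrow> complex) \<Rightarrow> nat \<Rightarrow> complex" where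
  "flux a g x n = (if n = 0 then 0 else a (n - 1) *\<^sub>R (twist g x n - twist g x (n - 1)))"

lemma norm_twist: "\<bar>g\<bar> = 1 \<Longrightarrow> cmod (twist g x n) = cmod (x n)"
  by (simp add: twist_def norm_mult norm_power)

text \<open>Neighbouring factors \<open>(-g)^n\<close> differ by \<open>-g\<close>, and
  \<open>g * g = 1\<close>; this turns the recurrence into one half of a first-order system for the
  twisted sequence and its flux. The other half is \<open>twist_Suc\<close>.\<close>

lemma flux_Suc:
  assumes "\<bar>g\<bar> = 1"
  shows "flux a g x (Suc n) = flux a g x n + jweight a b g n *\<^sub>R twist g x n - g *\<^sub>R twist g (jac a b x) n"
proof -
  have g: "complex_of_real g * complex_of_real g = 1"
    using assms by (metis abs_mult_self_eq mult_1 of_real_1 of_real_mult)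
  then have g': "complex_of_real g * (complex_of_real g * c) = c" for c
    by (metis mult.assoc mult_1)
  show ?thesis
    by (cases n) (simp_all add: flux_def jweight_def twist_def jac_def scaleR_conv_of_real
        algebra_simps g g')
qed

lemma twist_Suc:
  assumes "a n \<noteq> 0"
  shows "twist g x (Suc n) = twist g x n + (1 / a n) *\<^sub>R flux a g x (Suc n)"
  using assms by (simp add: flux_def)

lemma inner_twist:
  assumes "\<bar>g\<bar> = 1"
  shows "inner (twist g x n) (twist g y n) = Re (x n * cnj (y n))"
proof -
  have "(- g) ^ n * (- g) ^ n = 1"
    using assms by (metis abs_minus_cancel abs_mult_self_eq mult_1 power_mult_distrib power_one)
  then show ?thesis
    by (simp add: twist_def inner_complex_def algebra_simps)
qed

text \<open>Summation by parts; no boundary term arises at \<open>0\<close> because the flux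
  vanishes there.\<close>

lemma form_identity:
  assumes "\<bar>g\<bar> = 1"
  shows "(\<Sum>n<M. inner (g *\<^sub>R twist g (jac a b x) n) (twist g x n))
    = (\<Sum>n<M. jweight a b g n * (cmod (x n))\<^sup>2) + (\<Sum>n<M. a n * (cmod (twist g x (Suc n) - twist g x n))\<^sup>2)
      - inner (flux a g x M) (twist g x M)"
proof (induction M)
  case (Suc M)
  let ?p = "twist g x" and ?q = "flux a g x"
  have "g *\<^sub>R twist g (jac a b x) M = ?q M + jweight a b g M *\<^sub>R ?p M - ?q (Suc M)"
    using flux_Suc[OF assms, of a x M b] by simp
  then have "inner (g *\<^sub>R twist g (jac a b x) M) (?p M)
      = inner (?q M) (?p M) + jweight a b g M * (cmod (x M))\<^sup>2 - inner (?q (Suc M)) (?p M)"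
    by (simp only: inner_diff_left inner_add_left inner_scaleR_left power2_norm_eq_inner[symmetric]
        norm_twist[OF assms])
  moreover have "inner (?q (Suc M)) (?p (Suc M)) - inner (?q (Suc M)) (?p M)
      = a M * (cmod (?p (Suc M) - ?p M))\<^sup>2"
    by (simp add: inner_diff_right inner_diff_left flux_def power2_norm_eq_inner algebra_simps)
  ultimately show ?case
    using Suc.IH by (simp only: sum.lessThan_Suc)
qed (simp add: flux_def)

lemma jacobi_min_form_bound:
  assumes a: "\<And>n. a n \<ge> 0" and g: "\<bar>g\<bar> = 1" and w: "\<And>n. jweight a b g n + c \<ge> 0"
    and uf: "(u, f) \<in> jacobi_min a b"
  shows "(\<Sum>n<N. (jweight a b g n + c) * (cmod (coord u n))\<^sup>2) \<le> g * inner f u + c * (norm u)\<^sup>2"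
proof -
  from uf have "finite {n. coord u n \<noteq> 0}" and f: "\<And>n. coord f n = jac a b (coord u) n"
    by (auto simp: jacobi_min_eq jacobi_max_def)
  then obtain M' where M': "\<And>n. coord u n \<noteq> 0 \<Longrightarrow> n < M'"
    by (auto simp: finite_nat_set_iff_bounded)
  define M where "M = max N M'"
  have u0: "coord u n = 0" if "n \<ge> M" for n
    using M'[of n] that by (force simp: M_def)
  have f': "coord f = jac a b (coord u)" using f by blast
  have "cinner f u = cnj (\<Sum>n<M. coord u n * cnj (coord f n))"
    using u0 by (subst cinner_commute) (simp add: cinner_finite[of M])
  then have inner: "g * inner f u = (\<Sum>n<M. inner (g *\<^sub>R twist g (coord f) n) (twist g (coord u) n))"
    by (simp add: inner_ell2_def inner_twist[OF g] sum_distrib_left mult.commute)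
  have norm: "(norm u)\<^sup>2 = (\<Sum>n<M. (cmod (coord u n))\<^sup>2)"
    unfolding norm_ell2_sq by (intro suminf_finite) (auto simp: u0)
  have "(\<Sum>n<N. (jweight a b g n + c) * (cmod (coord u n))\<^sup>2)
      \<le> (\<Sum>n<M. (jweight a b g n + c) * (cmod (coord u n))\<^sup>2)"
    using w by (intro sum_mono2) (auto simp: M_def)
  also have "\<dots> = (\<Sum>n<M. jweight a b g n * (cmod (coord u n))\<^sup>2) + c * (norm u)\<^sup>2"
    by (simp add: norm algebra_simps sum.distrib sum_distrib_left)
  also have "(\<Sum>n<M. jweight a b g n * (cmod (coord u n))\<^sup>2) \<le> g * inner f u"
  proof -
    have "(\<Sum>n<M. a n * (cmod (twist g (coord u) (Suc n) - twist g (coord u) n))\<^sup>2) \<ge> 0"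
      using a by (intro sum_nonneg) auto
    moreover have "twist g (coord u) M = 0"
      using u0[of M] by (simp add: twist_def)
    ultimately show ?thesis
      unfolding inner f' form_identity[OF g] by simp
  qed
  finally show ?thesis by simp
qed

text \<open>With a fixed cutoff \<open>N\<close> both sides are continuous on the graph, although
  the weights may be unbounded, so the estimate passes to the closure.\<close>

lemma closure_jacobi_form_bound:
  assumes a: "\<And>n. a n \<ge> 0" and g: "\<bar>g\<bar> = 1" and w: "\<And>n. jweight a b g n + c \<ge> 0"
    and uf: "(u, f) \<in> closure (jacobi_min a b)"
  shows "(\<Sum>n<N. (jweight a b g n + c) * (cmod (coord u n))\<^sup>2) \<le> g * inner f u + c * (norm u)\<^sup>2"
proof -
  have "closure (jacobi_min a b) \<subseteq>
      {x. (\<Sum>n<N. (jweight a b g n + c) * (cmod (coord (fst x) n))\<^sup>2)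
        \<le> g * inner (snd x) (fst x) + c * (norm (fst x))\<^sup>2}"
    by (intro closure_minimal closed_Collect_le continuous_intros continuous_on_coord)
      (auto intro: jacobi_min_form_bound[OF a g w])
  with uf show ?thesis by force
qed

text \<open>As the shifted weight is nonnegative, the real product of twisted sequence and flux
  starts at \<open>0\<close> and stays nonnegative, so each step can only enlarge the
  modulus.\<close>

lemma solution_norm_mono:
  assumes a: "\<And>n. a n > 0" and g: "\<bar>g\<bar> = 1" and w: "\<And>n. jweight a b g n + c \<ge> 0"
    and x: "\<And>n. jac a b x n = complex_of_real (- g * c) * x n"
  shows "incseq (\<lambda>n. cmod (x n))"
proof -
  let ?p = "twist g x" and ?q = "flux a g x"
  have F: "g *\<^sub>R twist g (jac a b x) n = - c *\<^sub>R ?p n" for n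
  proof -
    have "complex_of_real g * complex_of_real g = 1"
      using g by (metis abs_mult_self_eq mult_1 of_real_1 of_real_mult)
    moreover have "complex_of_real g * (P * (- complex_of_real g * C * X))
        = - ((complex_of_real g * complex_of_real g) * (C * (P * X)))" for P C X
      by (simp only: mult_minus_left mult_minus_right ac_simps)
    ultimately have "complex_of_real g * (P * (- complex_of_real g * C * X)) = - (C * (P * X))" for P C X
      by (simp only: mult_1)
    then show ?thesis
      unfolding x twist_def scaleR_conv_of_real by (simp only: of_real_mult of_real_minus mult_minus_left)
  qed
  have q: "?q (Suc n) = ?q n + (jweight a b g n + c) *\<^sub>R ?p n" for n
    unfolding flux_Suc[OF g, of a x n b] F by (simp add: algebra_simps)
  have p: "?p (Suc n) = ?p n + (1 / a n) *\<^sub>R ?q (Suc n)" for n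
    using a[of n] by (intro twist_Suc) simp
  have step: "inner (?p n) (?q n) \<ge> 0 \<Longrightarrow> inner (?p n) (?q (Suc n)) \<ge> 0" for n
    using w[of n] by (simp add: q inner_add_right)
  have pq: "inner (?p n) (?q n) \<ge> 0" for n
  proof (induction n)
    case (Suc n)
    have "inner (?p (Suc n)) (?q (Suc n)) = inner (?p n) (?q (Suc n)) + (1 / a n) * inner (?q (Suc n)) (?q (Suc n))"
      by (subst p) (simp add: inner_add_left)
    with step[OF Suc] a[of n] show ?case by simp
  qed (simp add: flux_def)
  show ?thesis
  proof (rule incseq_SucI)
    fix n
    have "(cmod (?p (Suc n)))\<^sup>2 = (cmod (?p n))\<^sup>2 + 2 * ((1 / a n) * inner (?p n) (?q (Suc n)))
        + (1 / a n)\<^sup>2 * (cmod (?q (Suc n)))\<^sup>2"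
      unfolding p power2_norm_eq_inner
      by (simp add: inner_add_left inner_add_right inner_commute power2_eq_square)
    then have "(cmod (?p n))\<^sup>2 \<le> (cmod (?p (Suc n)))\<^sup>2"
      using step[OF pq[of n]] a[of n] by simp
    then show "cmod (x n) \<le> cmod (x (Suc n))"
      unfolding norm_twist[OF g] by (rule power2_le_imp_le) simp
  qed
qed

lemma filterlim_at_top_bdd_below:
  fixes w :: "nat \<Rightarrow> real"
  assumes "filterlim w at_top sequentially"
  obtains c where "c \<ge> 0" "\<And>n. w n + c \<ge> 1"
proof -
  obtain N where N: "\<And>n. n \<ge> N \<Longrightarrow> w n \<ge> 1"
    using assms unfolding filterlim_at_top eventually_sequentially by blast
  define c where "c = 1 + (\<Sum>n<N. \<bar>w n\<bar>)"
  have "w n + c \<ge> 1" for n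
  proof (cases "n < N")
    case True
    then have "\<bar>w n\<bar> \<le> (\<Sum>n<N. \<bar>w n\<bar>)" by (intro member_le_sum) auto
    then show ?thesis by (simp add: c_def)
  next
    case False
    then show ?thesis using N[of n] by (simp add: c_def sum_nonneg add_nonneg_nonneg)
  qed
  moreover have "c \<ge> 0" by (simp add: c_def sum_nonneg add_nonneg_nonneg)
  ultimately show thesis using that by blast
qed

text \<open>Shifting the form by a large \<open>c\<close> makes it dominate the square of the norm.
  This bounds the spectrum from one side and supplies the point \<open>- g * c\<close> for
  self-adjointness; the divergence of the weights supplies compactness.\<close>

lemma closure_jacobi_semibounded:
  assumes a: "\<And>n. a n > 0" and g: "\<bar>g\<bar> = 1"
    and w: "filterlim (jweight a b g) at_top sequentially"
  defines "T \<equiv> closure (jacobi_min a b)"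
  shows "self_adjoint T" and "discrete_spectrum T"
    and "\<exists>C. \<forall>z\<in>spectrum T. C \<le> g * Re z"
proof -
  obtain c where c: "c \<ge> 0" "\<And>n. jweight a b g n + c \<ge> 1"
    using filterlim_at_top_bdd_below[OF w] by blast
  have c0: "jweight a b g n + c \<ge> 0" for n using c(2)[of n] by simp
  have gg: "g * g = 1" using g by (metis abs_mult_self_eq mult_1)
  have form: "(\<Sum>n<N. (jweight a b g n + c) * (cmod (coord u n))\<^sup>2) \<le> g * inner f u + c * (norm u)\<^sup>2"
    if "(u, f) \<in> T" for u f N
    using closure_jacobi_form_bound[OF less_imp_le[OF a] g c0] that unfolding T_def by blast
  have form': "(norm u)\<^sup>2 \<le> g * inner f u + c * (norm u)\<^sup>2" if uf: "(u, f) \<in> T" for u f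
  proof -
    have "(\<Sum>n<N. (cmod (coord u n))\<^sup>2) \<le> g * inner f u + c * (norm u)\<^sup>2" for N
    proof -
      have "(\<Sum>n<N. 1 * (cmod (coord u n))\<^sup>2) \<le> (\<Sum>n<N. (jweight a b g n + c) * (cmod (coord u n))\<^sup>2)"
        by (intro sum_mono mult_right_mono c) auto
      with form[OF uf, of N] show ?thesis by simp
    qed
    then have "(\<Sum>n. (cmod (coord u n))\<^sup>2) \<le> g * inner f u + c * (norm u)\<^sup>2"
      by (intro suminf_le_const summable_coord)
    then show ?thesis by (simp add: norm_ell2_sq)
  qed
  show sa: "self_adjoint T"
    unfolding T_def
  \<comment> \<open>Subtracting \<open>- g * c\<close> from the operator adds exactly
    \<open>c * (norm u)\<^sup>2\<close> to \<open>g * inner f u\<close>, because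
    \<open>g * g = 1\<close>.\<close>
  proof (rule self_adjoint_closure_jacobi[of 1 _ _ "- g * c"])
    fix u f assume "(u, f) \<in> closure (jacobi_min a b)"
    then have "(norm u)\<^sup>2 \<le> g * inner f u + c * (norm u)\<^sup>2"
      by (intro form') (simp add: T_def)
    also have "\<dots> = g * inner f u + (g * g) * c * inner u u"
      by (simp add: gg power2_norm_eq_inner)
    also have "\<dots> = g * inner (f - (- g * c) *\<^sub>R u) u"
      by (simp add: inner_diff_left inner_add_left algebra_simps)
    also have "\<dots> \<le> \<bar>g\<bar> * \<bar>inner (f - (- g * c) *\<^sub>R u) u\<bar>"
      by (metis abs_ge_self abs_mult)
    also have "\<dots> \<le> norm (f - (- g * c) *\<^sub>R u) * norm u"
      by (simp add: g Cauchy_Schwarz_ineq2 del: scaleR_minus_left mult_minus_left)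
    finally have "norm u * norm u \<le> norm (f - (- g * c) *\<^sub>R u) * norm u"
      by (simp add: power2_eq_square)
    then have "norm u \<le> norm (f - (- g * c) *\<^sub>R u)"
      by (cases "norm u = 0") (auto simp: mult_le_cancel_right)
    then show "1 * norm u \<le> norm (f - complex_of_real (- g * c) *\<^sub>C u)"
      by (simp add: scaleR_ell2_def)
  next
    fix u assume "u \<in> eigenspace (jacobi_max a b) (complex_of_real (- g * c))"
    then have "jac a b (coord u) n = complex_of_real (- g * c) * coord u n" for n
      by (simp add: eigenspace_def jacobi_max_def del: complex_ell2.scale_minus_left)
    then have inc: "incseq (\<lambda>n. cmod (coord u n))"
      by (rule solution_norm_mono[OF a g c0])
    \<comment> \<open>The moduli are nondecreasing, yet square summability forces them to tend to
      zero.\<close>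
    have "(\<lambda>n. sqrt ((cmod (coord u n))\<^sup>2)) \<longlonglongrightarrow> sqrt 0"
      by (intro tendsto_real_sqrt summable_LIMSEQ_zero summable_coord)
    then have "cmod (coord u n) \<le> 0" for n
      by (intro incseq_le[OF inc]) simp
    then show "u = 0"
      by (intro ell2_eqI) simp
  qed simp
  have compact: "\<exists>\<phi> L. strict_mono \<phi> \<and> (\<lambda>k. u (\<phi> k)) \<longlonglongrightarrow> L"
    if uf: "\<And>k. (u k, f k) \<in> T" and u: "\<And>k. norm (u k) \<le> K" and f: "\<And>k. norm (f k) \<le> K"
    for u f :: "nat \<Rightarrow> ell2" and K
  proof -
    \<comment> \<open>A bound for the shifted form on the given part of the graph; the summand
      \<open>1\<close> makes it positive.\<close>
    define D where "D = K * K + c * K\<^sup>2 + 1"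
    have "K \<ge> 0" using u[of 0] norm_ge_zero order_trans by blast
    then have D: "D > 0" using c(1) by (simp add: D_def add_nonneg_pos)
    have bound: "(\<Sum>n<N. (jweight a b g n + c) * (cmod (coord (u k) n))\<^sup>2) \<le> D" for k N
    proof -
      have "g * inner (f k) (u k) \<le> \<bar>g\<bar> * \<bar>inner (f k) (u k)\<bar>"
        by (metis abs_ge_self abs_mult)
      also have "\<dots> \<le> norm (f k) * norm (u k)"
        by (simp add: g Cauchy_Schwarz_ineq2)
      also have "\<dots> \<le> K * K"
        by (intro mult_mono u f \<open>K \<ge> 0\<close>) simp
      finally have "g * inner (f k) (u k) \<le> K * K" .
      moreover have "c * (norm (u k))\<^sup>2 \<le> c * K\<^sup>2"
        by (intro mult_left_mono power_mono u c) simp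
      ultimately show ?thesis
        using form[OF uf[of k], of N] by (simp add: D_def)
    qed
    obtain \<phi> L where "strict_mono \<phi>" "(u \<circ> \<phi>) \<longlonglongrightarrow> L"
    proof (rule square_summable_conv_subseq[OF u])
      fix \<epsilon> :: real assume \<epsilon>: "\<epsilon> > 0"
      \<comment> \<open>Once the weights exceed \<open>D / \<epsilon>\<close>, the bounded form
        leaves at most \<open>\<epsilon>\<close> for the tail.\<close>
      obtain N where N: "\<And>n. n \<ge> N \<Longrightarrow> jweight a b g n \<ge> D / \<epsilon>"
        using w unfolding filterlim_at_top eventually_sequentially by blast
      have "(\<Sum>n=N..<M. (cmod (coord (u k) n))\<^sup>2) \<le> \<epsilon>" for k M
      proof -
        have "D / \<epsilon> * (\<Sum>n=N..<M. (cmod (coord (u k) n))\<^sup>2)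
            \<le> (\<Sum>n=N..<M. (jweight a b g n + c) * (cmod (coord (u k) n))\<^sup>2)"
          unfolding sum_distrib_left using N c(1)
          by (intro sum_mono mult_right_mono) (auto intro: add_increasing2)
        also have "\<dots> \<le> (\<Sum>n<M. (jweight a b g n + c) * (cmod (coord (u k) n))\<^sup>2)"
          using c0 by (intro sum_mono2) auto
        also have "\<dots> \<le> D" by (rule bound)
        finally show ?thesis
          using D \<epsilon> by (simp add: field_simps)
      qed
      then show "\<exists>N. \<forall>\<^sub>F k in sequentially. \<forall>M. (\<Sum>n=N..<M. (cmod (coord (u k) n))\<^sup>2) \<le> \<epsilon>"
        by (auto intro!: exI[of _ N])
    qed
    then show ?thesis by (auto simp: o_def)
  qed
  have a0: "a n \<noteq> 0" for n using a[of n] by simp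
  have sub: "jacobi_min a b \<subseteq> T" unfolding T_def by (rule closure_subset)
  show "discrete_spectrum T"
    by (rule discrete_spectrumI(1)[OF a0 sa sub]) (rule compact)
  \<comment> \<open>Every spectral point has an eigenvector, and the form estimate at that vector
    bounds \<open>g * Re z\<close>.\<close>
  have "1 - c \<le> g * Re z" if z: "z \<in> spectrum T" for z
  proof -
    have "\<exists>u\<in>eigenspace T z. u \<noteq> 0"
      by (rule discrete_spectrumI(2)[OF a0 sa sub _ z]) (rule compact)
    then obtain u where u: "u \<in> eigenspace T z" "u \<noteq> 0" by blast
    then have "(norm u)\<^sup>2 \<le> g * inner (z *\<^sub>C u) u + c * (norm u)\<^sup>2"
      by (intro form') (simp add: eigenspace_def)
    also have "inner (z *\<^sub>C u) u = Re z * (norm u)\<^sup>2"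
      by (simp add: inner_ell2_def cinner_scaleC_left cinner_self_norm del: of_real_power)
    finally have "1 * (norm u)\<^sup>2 \<le> (g * Re z + c) * (norm u)\<^sup>2"
      by (simp add: algebra_simps)
    then show ?thesis
      using u(2) by (simp only: mult_le_cancel_right) auto
  qed
  then show "\<exists>C. \<forall>z\<in>spectrum T. C \<le> g * Re z" by blast
qed

subsection \<open>The limit-circle case\<close>

text \<open>The polynomials of the first kind of the Jacobi matrix, evaluated at
  \<open>z\<close>.\<close>

fun jacobi_solution :: "(nat \<Rightarrow> real) \<Rightarrow> (nat \<Rightarrow> real) \<Rightarrow> complex \<Rightarrow> nat \<Rightarrow> complex" where
  "jacobi_solution a b z 0 = 1"
| "jacobi_solution a b z (Suc 0) = (z - b 0) / a 0"
| "jacobi_solution a b z (Suc (Suc n)) =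
     ((z - b (Suc n)) * jacobi_solution a b z (Suc n) - a n * jacobi_solution a b z n) / a (Suc n)"

lemma jac_jacobi_solution:
  assumes "\<And>n. a n \<noteq> 0"
  shows "jac a b (jacobi_solution a b z) n = z * jacobi_solution a b z n"
  using assms by (cases n) (auto simp: jac_def field_simps)

text \<open>Square summable solutions give the maximal operator an eigenvector at every
  \<open>z\<close>, in particular at \<open>\<i>\<close> and \<open>-\<i>\<close>. The common
  majorant \<open>m\<close> makes tails uniformly small on bounded parts of the graph, which is the
  compactness behind discreteness.\<close>

lemma limit_circle_discrete:
  assumes a: "\<And>n. a n \<noteq> 0"
    and sol: "\<And>z x. (\<And>n. jac a b x n = z * x n) \<Longrightarrow> summable (\<lambda>n. (cmod (x n))\<^sup>2)"
    and m: "summable m"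
    and dom: "\<And>u f n. (u, f) \<in> jacobi_max a b \<Longrightarrow>
      (cmod (coord u n))\<^sup>2 \<le> ((norm u)\<^sup>2 + (norm f)\<^sup>2) * m n"
  shows "deficiency_indices (jacobi_min a b) = (1, 1)"
    and "self_adjoint A \<Longrightarrow> jacobi_min a b \<subseteq> A \<Longrightarrow> discrete_spectrum A"
proof -
  have "cdim (eigenspace (jacobi_max a b) z) = 1" for z
  proof -
    define u where "u = Abs_ell2 (jacobi_solution a b z)"
    have u: "coord u = jacobi_solution a b z"
      unfolding u_def using sol[OF jac_jacobi_solution[OF a]] by (simp add: Abs_ell2_inverse)
    show ?thesis
    proof (rule cdim_eigenspace[OF a linear_jacobi_max subset_refl])
      show "u \<in> eigenspace (jacobi_max a b) z"
        by (simp add: eigenspace_def jacobi_max_def u jac_jacobi_solution[OF a])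
      show "u \<noteq> 0"
        using u by (metis coord_zero jacobi_solution.simps(1) zero_neq_one)
    qed
  qed
  then show "deficiency_indices (jacobi_min a b) = (1, 1)"
    by (simp add: deficiency_indices_def adjoint_jacobi_min)
next
  assume A: "self_adjoint A" "jacobi_min a b \<subseteq> A"
  show "discrete_spectrum A"
  proof (rule discrete_spectrumI(1)[OF a A])
    fix u f :: "nat \<Rightarrow> ell2" and K
    assume uf: "\<And>k. (u k, f k) \<in> A" and u: "\<And>k. norm (u k) \<le> K" and f: "\<And>k. norm (f k) \<le> K"
    have "K \<ge> 0" using u[of 0] norm_ge_zero order_trans by blast
    \<comment> \<open>The sign of \<open>m\<close> follows by applying \<open>dom\<close> to a unit
      vector.\<close>
    have mpos: "0 \<le> m n" for n
    proof -
      obtain v where v: "coord v = (\<lambda>k. if k = n then 1 else 0)"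
        using unit_vector by blast
      then have "v \<in> Domain (jacobi_min a b)" by (simp add: Domain_jacobi_min)
      then obtain h where "(v, h) \<in> jacobi_max a b" using jacobi_min_subset_max by blast
      from dom[OF this, of n] have "1 \<le> ((norm v)\<^sup>2 + (norm h)\<^sup>2) * m n" by (simp add: v)
      then show ?thesis
        by (smt (verit) mult_nonneg_nonpos zero_le_power2)
    qed
    have bound: "(cmod (coord (u k) n))\<^sup>2 \<le> (2 * K\<^sup>2 + 1) * m n" for k n
    proof -
      have "(cmod (coord (u k) n))\<^sup>2 \<le> ((norm (u k))\<^sup>2 + (norm (f k))\<^sup>2) * m n"
        using uf[of k] self_adjoint_subset_jacobi_max[OF A] by (intro dom) blast
      also have "\<dots> \<le> (2 * K\<^sup>2 + 1) * m n"
        using power_mono[OF u[of k], of 2] power_mono[OF f[of k], of 2]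
        by (intro mult_right_mono mpos) auto
      finally show ?thesis .
    qed
    obtain \<phi> L where "strict_mono \<phi>" "(u \<circ> \<phi>) \<longlonglongrightarrow> L"
    proof (rule square_summable_conv_subseq[OF u])
      fix \<epsilon> :: real assume "\<epsilon> > 0"
      then have "\<epsilon> / (2 * K\<^sup>2 + 1) > 0"
        by (simp add: add_nonneg_pos)
      then obtain N where N: "\<And>M. norm (\<Sum>n=N..<M. m n) < \<epsilon> / (2 * K\<^sup>2 + 1)"
        using m unfolding summable_Cauchy by (metis order_refl)
      have "(\<Sum>n=N..<M. (cmod (coord (u k) n))\<^sup>2) \<le> \<epsilon>" for k M
      proof -
        have "(\<Sum>n=N..<M. (cmod (coord (u k) n))\<^sup>2) \<le> (\<Sum>n=N..<M. (2 * K\<^sup>2 + 1) * m n)"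
          by (intro sum_mono bound)
        also have "\<dots> = (2 * K\<^sup>2 + 1) * (\<Sum>n=N..<M. m n)"
          by (simp add: sum_distrib_left)
        also have "\<dots> \<le> (2 * K\<^sup>2 + 1) * (\<epsilon> / (2 * K\<^sup>2 + 1))"
          using N[of M] by (intro mult_left_mono) (auto simp: add_nonneg_pos)
        also have "\<dots> = \<epsilon>"
          using zero_le_power2[of K] by (simp add: nonzero_mult_div_cancel_left add_nonneg_pos less_imp_neq[symmetric])
        finally show ?thesis .
      qed
      then show "\<exists>N. \<forall>\<^sub>F k in sequentially. \<forall>M. (\<Sum>n=N..<M. (cmod (coord (u k) n))\<^sup>2) \<le> \<epsilon>"
        by (auto intro!: exI[of _ N])
    qed
    then show "\<exists>\<phi> L. strict_mono \<phi> \<and> (\<lambda>k. u (\<phi> k)) \<longlonglongrightarrow> L"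
      by (auto simp: o_def)
  qed
qed

subsection \<open>A perturbed quadratic energy\<close>

text \<open>Each factor \<open>1 + \<epsilon> n\<close> is at most
  \<open>exp (\<epsilon> n)\<close>, and the inhomogeneous terms may be multiplied by exponentials
  that are at least \<open>1\<close>.\<close>

lemma discrete_gronwall:
  fixes E \<epsilon> y :: "nat \<Rightarrow> real"
  assumes step: "\<And>n. n \<ge> N \<Longrightarrow> E (Suc n) \<le> (1 + \<epsilon> n) * E n + y n"
    and nonneg: "\<And>n. \<epsilon> n \<ge> 0" "\<And>n. y n \<ge> 0" "E N \<ge> 0" and n: "n \<ge> N"
  shows "E n \<le> exp (\<Sum>k=N..<n. \<epsilon> k) * (E N + (\<Sum>k=N..<n. y k))"
  using n
proof (induction n rule: dec_induct)
  case (step n)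
  let ?S = "\<Sum>k=N..<n. \<epsilon> k" and ?Y = "\<Sum>k=N..<n. y k"
  have Y: "E N + ?Y \<ge> 0" using nonneg by (simp add: sum_nonneg)
  have "E (Suc n) \<le> (1 + \<epsilon> n) * E n + y n"
    using assms(1) step.hyps by simp
  also have "\<dots> \<le> (1 + \<epsilon> n) * (exp ?S * (E N + ?Y)) + y n"
    using nonneg(1)[of n] step.IH by (intro add_right_mono mult_left_mono) auto
  also have "\<dots> \<le> exp (\<epsilon> n) * (exp ?S * (E N + ?Y)) + exp (\<epsilon> n + ?S) * y n"
  proof (rule add_mono)
    show "(1 + \<epsilon> n) * (exp ?S * (E N + ?Y)) \<le> exp (\<epsilon> n) * (exp ?S * (E N + ?Y))"
      using Y by (intro mult_right_mono exp_ge_add_one_self) auto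
    have "1 \<le> exp (\<epsilon> n + ?S)"
      using nonneg(1) by (simp add: sum_nonneg add_nonneg_nonneg)
    then show "y n \<le> exp (\<epsilon> n + ?S) * y n"
      using mult_right_mono[of 1 "exp (\<epsilon> n + ?S)" "y n"] nonneg(2)[of n] by simp
  qed
  also have "\<dots> = exp (\<epsilon> n + ?S) * (E N + (?Y + y n))"
    by (simp add: exp_add algebra_simps)
  finally show ?case
    using step.hyps by (simp add: add.commute)
qed simp

text \<open>On \<open>complex\<close>, taken as a real inner product space, the middle product is
  \<open>Re (p * cnj q)\<close>.\<close>

definition qform :: "real \<Rightarrow> real \<Rightarrow> real \<Rightarrow> 'a :: real_inner \<Rightarrow> 'a \<Rightarrow> real" where
  "qform A B C p q = A * inner p p + B * inner p q + C * inner q q"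

text \<open>AM-GM for \<open>sqrt A * norm p\<close> and \<open>sqrt C * norm q\<close>: with
  \<open>\<bar>B\<bar>\<close> at most the root of \<open>A * C\<close>, the cross term uses up at
  most half of the diagonal part.\<close>

lemma qform_ge_half:
  fixes p q :: "'a :: real_inner"
  assumes "A > 0" "C > 0" "A * C = \<kappa>" "\<bar>B\<bar> \<le> sqrt \<kappa>"
  shows "\<bar>B * inner p q\<bar> \<le> (A * inner p p + C * inner q q) / 2"
    and "sqrt \<kappa> * \<bar>inner p q\<bar> \<le> (A * inner p p + C * inner q q) / 2"
    and "A * inner p p + C * inner q q \<le> 2 * qform A B C p q"
proof -
  have "0 \<le> (sqrt A * norm p - sqrt C * norm q)\<^sup>2" by simp
  also have "\<dots> = A * inner p p + C * inner q q - 2 * (sqrt (A * C) * (norm p * norm q))"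
    using assms(1,2) by (simp add: power2_diff power_mult_distrib power2_norm_eq_inner real_sqrt_mult algebra_simps)
  finally have "sqrt \<kappa> * (norm p * norm q) \<le> (A * inner p p + C * inner q q) / 2"
    using assms(3) by simp
  moreover have k: "sqrt \<kappa> * \<bar>inner p q\<bar> \<le> sqrt \<kappa> * (norm p * norm q)"
    using assms by (intro mult_left_mono Cauchy_Schwarz_ineq2) (auto simp flip: assms(3))
  ultimately show 1: "sqrt \<kappa> * \<bar>inner p q\<bar> \<le> (A * inner p p + C * inner q q) / 2" by simp
  moreover have "\<bar>B * inner p q\<bar> \<le> sqrt \<kappa> * \<bar>inner p q\<bar>"
    unfolding abs_mult by (intro mult_right_mono assms) simp
  ultimately show 2: "\<bar>B * inner p q\<bar> \<le> (A * inner p p + C * inner q q) / 2" by simp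
  show "A * inner p p + C * inner q q \<le> 2 * qform A B C p q"
    using abs_le_D2[OF 2] by (simp add: qform_def)
qed

lemma qform_nonneg:
  assumes "A > 0" "C > 0" "A * C = \<kappa>" "\<bar>B\<bar> \<le> sqrt \<kappa>"
  shows "qform A B C p q \<ge> 0"
proof -
  have "0 \<le> A * inner p p + C * inner q q" using assms by simp
  with qform_ge_half(3)[OF assms, of p q] show ?thesis by linarith
qed

text \<open>Obtained by expanding the nonnegative form at
  \<open>(e *\<^sub>R p - x, e *\<^sub>R q - y)\<close> and dividing by \<open>e\<close>.\<close>

lemma qform_young:
  assumes "\<And>p q :: 'a :: real_inner. qform A B C p q \<ge> 0" and e: "e > 0"
  shows "qform A B C (p + x) (q + y) \<le> (1 + e) * qform A B C p q + (1 + 1 / e) * qform A B C x (y :: 'a)"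
proof -
  have "0 \<le> qform A B C (e *\<^sub>R p - x) (e *\<^sub>R q - y) / e"
    using assms by simp
  also have "\<dots> = (1 + e) * qform A B C p q + (1 + 1 / e) * qform A B C x y - qform A B C (p + x) (q + y)"
    using e by (simp add: qform_def inner_diff_left inner_diff_right inner_add_left inner_add_right
        inner_commute field_simps)
  finally show ?thesis by simp
qed

text \<open>The pullback of the form under one homogeneous step, in which \<open>q\<close> is
  updated first and \<open>p\<close> then uses the new \<open>q\<close>.\<close>

lemma qform_transfer:
  fixes p q :: "'a :: real_inner"
  shows "qform A B C (p + r *\<^sub>R (q + v *\<^sub>R p)) (q + v *\<^sub>R p)
    = qform (A * (1 + r * v)\<^sup>2 + B * (v * (1 + r * v)) + C * v\<^sup>2)
        (2 * A * r * (1 + r * v) + B * (1 + 2 * (r * v)) + 2 * C * v)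
        (A * r\<^sup>2 + B * r + C) p q"
  by (simp add: qform_def inner_add_left inner_add_right inner_commute power2_eq_square algebra_simps)

text \<open>The homogeneous step changes the coefficients only by errors of size \<open>e\<close>,
  which costs a factor \<open>1 + O(e)\<close> since the form is comparable to its diagonal part.
  The forcing \<open>h\<close> is split off by \<open>qform_young\<close> with the same
  \<open>e\<close>, hence the factor \<open>1 / e\<close>.\<close>

lemma qform_step:
  fixes p q h :: "'a :: real_inner"
  assumes old: "A > 0" "C > 0" "A * C = \<kappa>" "\<bar>B\<bar> \<le> sqrt \<kappa>"
    and new: "A' > 0" "C' > 0" "A' * C' = \<kappa>" "\<bar>B'\<bar> \<le> sqrt \<kappa>"
    and e: "0 < e" "e \<le> 1"
    and P: "\<bar>A' * (1 + r * v)\<^sup>2 + B' * (v * (1 + r * v)) + C' * v\<^sup>2 - A\<bar> \<le> e * A"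
    and X: "\<bar>2 * A' * r * (1 + r * v) + B' * (1 + 2 * (r * v)) + 2 * C' * v - B\<bar> \<le> e"
    and Q: "\<bar>A' * r\<^sup>2 + B' * r + C' - C\<bar> \<le> e * C"
    and q': "q' = q + v *\<^sub>R p + h" and p': "p' = p + r *\<^sub>R q'"
  shows "qform A' B' C' p' q' \<le> (1 + (5 + 2 / sqrt \<kappa>) * e) * qform A B C p q + 4 * C / e * inner h h"
proof -
  have \<kappa>: "\<kappa> > 0" using old by auto
  let ?E = "qform A B C p q" and ?q = "q + v *\<^sub>R p"
  have E: "?E \<ge> 0" by (rule qform_nonneg[OF old])
  define P' X' Q' where "P' = A' * (1 + r * v)\<^sup>2 + B' * (v * (1 + r * v)) + C' * v\<^sup>2"
    and "X' = 2 * A' * r * (1 + r * v) + B' * (1 + 2 * (r * v)) + 2 * C' * v"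
    and "Q' = A' * r\<^sup>2 + B' * r + C'"
  have "qform A' B' C' (p + r *\<^sub>R ?q) ?q - ?E
      = (P' - A) * inner p p + (X' - B) * inner p q + (Q' - C) * inner q q"
    unfolding qform_transfer P'_def X'_def Q'_def by (simp add: qform_def algebra_simps)
  also have "\<dots> \<le> (e * A) * inner p p + e * \<bar>inner p q\<bar> + (e * C) * inner q q"
  proof (intro add_mono)
    show "(P' - A) * inner p p \<le> e * A * inner p p"
      using P unfolding P'_def by (intro mult_right_mono) auto
    show "(Q' - C) * inner q q \<le> e * C * inner q q"
      using Q unfolding Q'_def by (intro mult_right_mono) auto
    have "(X' - B) * inner p q \<le> \<bar>X' - B\<bar> * \<bar>inner p q\<bar>"
      by (metis abs_ge_self abs_mult)
    also have "\<dots> \<le> e * \<bar>inner p q\<bar>"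
      using X unfolding X'_def by (intro mult_right_mono) auto
    finally show "(X' - B) * inner p q \<le> e * \<bar>inner p q\<bar>" .
  qed
  \<comment> \<open>The error in the middle coefficient is absolute; since
    \<open>A * C = \<kappa>\<close> is fixed, \<open>sqrt \<kappa>\<close> converts it into a
    relative one.\<close>
  also have "\<dots> = e * (A * inner p p + C * inner q q) + e / sqrt \<kappa> * (sqrt \<kappa> * \<bar>inner p q\<bar>)"
    using \<kappa> by (simp add: algebra_simps)
  also have "\<dots> \<le> e * (2 * ?E) + e / sqrt \<kappa> * ?E"
    using qform_ge_half(2,3)[OF old, of p q] e \<kappa> by (intro add_mono mult_left_mono) auto
  finally have hom: "qform A' B' C' (p + r *\<^sub>R ?q) ?q \<le> (1 + (2 + 1 / sqrt \<kappa>) * e) * ?E"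
    by (simp add: algebra_simps)
  have "qform A' B' C' p' q' = qform A' B' C' ((p + r *\<^sub>R ?q) + r *\<^sub>R h) (?q + h)"
    by (simp add: p' q' algebra_simps)
  also have "\<dots> \<le> (1 + e) * qform A' B' C' (p + r *\<^sub>R ?q) ?q + (1 + 1 / e) * qform A' B' C' (r *\<^sub>R h) h"
    by (intro qform_young qform_nonneg[OF new] e)
  also have "\<dots> \<le> (1 + e) * ((1 + (2 + 1 / sqrt \<kappa>) * e) * ?E) + (2 / e) * (2 * C * inner h h)"
  proof (intro add_mono mult_mono)
    have "qform A' B' C' (r *\<^sub>R h) h = Q' * inner h h"
      by (simp add: qform_def Q'_def power2_eq_square algebra_simps)
    also have "Q' \<le> 2 * C"
      using Q mult_right_mono[OF e(2), of C] old(2) unfolding Q'_def by linarith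
    finally show "qform A' B' C' (r *\<^sub>R h) h \<le> 2 * C * inner h h"
      by (simp add: mult_right_mono)
    show "1 + 1 / e \<le> 2 / e" using e by (simp add: field_simps)
  qed (use e hom qform_nonneg[OF new] in auto)
  also have "(1 + e) * ((1 + (2 + 1 / sqrt \<kappa>) * e) * ?E) \<le> (1 + (5 + 2 / sqrt \<kappa>) * e) * ?E"
  proof -
    \<comment> \<open>With this \<open>K\<close> from the homogeneous step and
      \<open>e \<le> 1\<close>, the product \<open>(1 + e) * (1 + K * e)\<close> is at most
      \<open>1 + (1 + 2 * K) * e\<close>, which produces
      \<open>5 + 2 / sqrt \<kappa>\<close>.\<close>
    define K where "K = 2 + 1 / sqrt \<kappa>"
    have "K \<ge> 0" using \<kappa> by (simp add: K_def)
    then have "K * e * e \<le> K * e * 1"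
      using e by (intro mult_left_mono) auto
    then have "(1 + e) * (1 + K * e) \<le> 1 + (1 + 2 * K) * e"
      by (simp add: algebra_simps)
    also have "1 + 2 * K = 5 + 2 / sqrt \<kappa>" by (simp add: K_def)
    finally have "(1 + e) * (1 + K * e) * ?E \<le> (1 + (5 + 2 / sqrt \<kappa>) * e) * ?E"
      using E by (intro mult_right_mono)
    then show ?thesis by (simp add: K_def mult.assoc)
  qed
  finally show ?thesis by (simp add: algebra_simps)
qed

subsection \<open>First-order asymptotic expansions\<close>

text \<open>Two orders of precision: the diagonal energy coefficients need the \<open>1/n\<close>
  term, whereas the cross coefficient already carries a factor \<open>n powr (-1/2)\<close> and
  needs only its limit with an \<open>O(1/n)\<close> error.\<close>

definition asymp0 :: "(nat \<Rightarrow> real) \<Rightarrow> real \<Rightarrow> bool" where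
  "asymp0 f c \<longleftrightarrow> (\<lambda>n. f n - c) \<in> O(\<lambda>n. 1 / real n)"

definition asymp1 :: "(nat \<Rightarrow> real) \<Rightarrow> real \<Rightarrow> real \<Rightarrow> bool" where
  "asymp1 f c d \<longleftrightarrow> (\<lambda>n. f n - (c + d / real n)) \<in> O(\<lambda>n. 1 / (real n)\<^sup>2)"

lemma asymp1_cong:
  assumes "asymp1 f c d" "eventually (\<lambda>n. f n = g n) sequentially" "c = c'" "d = d'"
  shows "asymp1 g c' d'"
proof -
  have "eventually (\<lambda>n. f n - (c + d / real n) = g n - (c' + d' / real n)) sequentially"
    using assms(2) by eventually_elim (simp add: assms)
  then show ?thesis
    using assms(1) unfolding asymp1_def by (subst (asm) landau_o.big.in_cong)
qed

lemma asymp0_cong: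
  assumes "asymp0 f c" "eventually (\<lambda>n. f n = g n) sequentially" "c = c'"
  shows "asymp0 g c'"
proof -
  have "eventually (\<lambda>n. f n - c = g n - c') sequentially"
    using assms(2) by eventually_elim (simp add: assms)
  then show ?thesis
    using assms(1) unfolding asymp0_def by (subst (asm) landau_o.big.in_cong)
qed

lemma asymp0_const: "asymp0 (\<lambda>_. c) c"
  by (simp add: asymp0_def)

lemma asymp1_const: "asymp1 (\<lambda>_. c) c 0"
  by (simp add: asymp1_def)

lemma asymp1_inverse: "asymp1 (\<lambda>n. 1 / real n) 0 1"
  by (simp add: asymp1_def)

lemma asymp0_add: "asymp0 f c \<Longrightarrow> asymp0 g d \<Longrightarrow> asymp0 (\<lambda>n. f n + g n) (c + d)"
  unfolding asymp0_def using sum_in_bigo(1)[of "\<lambda>n. f n - c" sequentially _ "\<lambda>n. g n - d"]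
  by (simp add: algebra_simps)

lemma asymp1_add: "asymp1 f c d \<Longrightarrow> asymp1 g c' d' \<Longrightarrow> asymp1 (\<lambda>n. f n + g n) (c + c') (d + d')"
  unfolding asymp1_def
  using sum_in_bigo(1)[of "\<lambda>n. f n - (c + d / real n)" sequentially _ "\<lambda>n. g n - (c' + d' / real n)"]
  by (simp add: algebra_simps add_divide_distrib)

lemma bigo_mult_bounded:
  fixes f g h :: "nat \<Rightarrow> real"
  assumes "f \<in> O(h)" "g \<in> O(\<lambda>_. 1)"
  shows "(\<lambda>n. f n * g n) \<in> O(h)"
  using landau_o.big.mult[OF assms] by simp

lemma bigo_mult_const:
  fixes h :: "nat \<Rightarrow> real"
  shows "(\<lambda>n. h n * d) \<in> O(h)"
  by (intro bigo_mult_bounded) auto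

lemma asymp0_bounded: "asymp0 f c \<Longrightarrow> f \<in> O(\<lambda>_. 1)"
proof -
  assume "asymp0 f c"
  then have "(\<lambda>n. f n - c) \<in> O(\<lambda>n. 1 / real n)" by (simp add: asymp0_def)
  also have "(\<lambda>n. 1 / real n) \<in> O(\<lambda>_. 1)" by real_asymp
  finally have "(\<lambda>n. (f n - c) + c) \<in> O(\<lambda>_. 1)"
    by (rule sum_in_bigo(1)) simp
  then show ?thesis by simp
qed

lemma asymp1_imp_asymp0: "asymp1 f c d \<Longrightarrow> asymp0 f c"
proof -
  assume "asymp1 f c d"
  then have "(\<lambda>n. f n - (c + d / real n)) \<in> O(\<lambda>n. 1 / (real n)\<^sup>2)" by (simp add: asymp1_def)
  also have "(\<lambda>n. 1 / (real n)\<^sup>2) \<in> O(\<lambda>n. 1 / real n)" by real_asymp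
  finally have "(\<lambda>n. (f n - (c + d / real n)) + 1 / real n * d) \<in> O(\<lambda>n. 1 / real n)"
    by (rule sum_in_bigo(1)[OF _ bigo_mult_const])
  then show ?thesis by (simp add: asymp0_def)
qed

lemma asymp0_mult:
  assumes f: "asymp0 f c" and g: "asymp0 g d"
  shows "asymp0 (\<lambda>n. f n * g n) (c * d)"
proof -
  have "(\<lambda>n. (f n - c) * g n) \<in> O(\<lambda>n. 1 / real n)"
    using f asymp0_bounded[OF g] unfolding asymp0_def by (rule bigo_mult_bounded)
  moreover have "(\<lambda>n. (g n - d) * c) \<in> O(\<lambda>n. 1 / real n)"
    using g unfolding asymp0_def by (rule bigo_mult_bounded) simp
  ultimately have "(\<lambda>n. (f n - c) * g n + (g n - d) * c) \<in> O(\<lambda>n. 1 / real n)"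
    by (rule sum_in_bigo(1))
  then show ?thesis by (simp add: asymp0_def algebra_simps)
qed

lemma asymp1_mult:
  assumes f: "asymp1 f c d" and g: "asymp1 g c' d'"
  shows "asymp1 (\<lambda>n. f n * g n) (c * c') (c * d' + d * c')"
proof -
  have "asymp0 (\<lambda>n. c + d / real n) c"
    by (rule asymp1_imp_asymp0[of _ _ d]) (simp add: asymp1_def)
  then have F: "(\<lambda>n. c + d / real n) \<in> O(\<lambda>_. 1)"
    by (rule asymp0_bounded)
  have "(\<lambda>n. (f n - (c + d / real n)) * g n + (g n - (c' + d' / real n)) * (c + d / real n)
      + 1 / (real n)\<^sup>2 * (d * d')) \<in> O(\<lambda>n. 1 / (real n)\<^sup>2)"
    using f g unfolding asymp1_def
    by (rule sum_in_bigo(1)[OF sum_in_bigo(1)[OF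
          bigo_mult_bounded[OF _ asymp0_bounded[OF asymp1_imp_asymp0[OF g]]]
          bigo_mult_bounded[OF _ F]] bigo_mult_const])
  moreover have "(f n - (c + d / real n)) * g n + (g n - (c' + d' / real n)) * (c + d / real n)
      + 1 / (real n)\<^sup>2 * (d * d') = f n * g n - (c * c' + (c * d' + d * c') / real n)" for n
    by (simp add: algebra_simps add_divide_distrib power2_eq_square)
  ultimately show ?thesis by (simp add: asymp1_def)
qed

text \<open>A factor without constant term is itself of order \<open>1/n\<close>, so the other
  factor is needed only to the coarser precision.\<close>

lemma asymp1_mult_asymp0:
  assumes f: "asymp1 f 0 d" and g: "asymp0 g c'"
  shows "asymp1 (\<lambda>n. f n * g n) 0 (d * c')"
proof -
  have "(\<lambda>n. 1 / real n * (g n - c')) \<in> O(\<lambda>n. 1 / real n * (1 / real n))"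
    using g unfolding asymp0_def by (intro landau_o.big.mult) auto
  from bigo_mult_bounded[OF this, of "\<lambda>_. d"]
  have "(\<lambda>n. 1 / real n * (g n - c') * d) \<in> O(\<lambda>n. 1 / (real n)\<^sup>2)"
    by (simp add: power2_eq_square)
  moreover have "(\<lambda>n. (f n - d / real n) * g n) \<in> O(\<lambda>n. 1 / (real n)\<^sup>2)"
    using f asymp0_bounded[OF g] by (intro bigo_mult_bounded) (simp_all add: asymp1_def)
  ultimately have "(\<lambda>n. 1 / real n * (g n - c') * d + (f n - d / real n) * g n) \<in> O(\<lambda>n. 1 / (real n)\<^sup>2)"
    by (rule sum_in_bigo(1))
  moreover have "1 / real n * (g n - c') * d + (f n - d / real n) * g n = f n * g n - d * c' / real n" for n
    by (simp add: algebra_simps diff_divide_distrib)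
  ultimately show ?thesis by (simp add: asymp1_def)
qed

lemma asymp1_times_n:
  assumes f: "asymp1 f 0 d"
  shows "asymp0 (\<lambda>n. real n * f n) d"
proof -
  have "(\<lambda>n. real n * (f n - d / real n)) \<in> O(\<lambda>n. real n * (1 / (real n)\<^sup>2))"
    using f unfolding asymp1_def by (intro landau_o.big.mult_left) simp
  also have "(\<lambda>n. real n * (1 / (real n)\<^sup>2)) \<in> O(\<lambda>n. 1 / real n)"
    by real_asymp
  finally have "(\<lambda>n. real n * (f n - d / real n)) \<in> O(\<lambda>n. 1 / real n)" .
  moreover have "\<forall>\<^sub>F n in sequentially. real n * (f n - d / real n) = real n * f n - d"
    using eventually_gt_at_top[of 0] by eventually_elim (simp add: algebra_simps)
  ultimately show ?thesis
    unfolding asymp0_def by (subst (asm) landau_o.big.in_cong)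
qed

lemma asymp0_tendsto: "asymp0 f c \<Longrightarrow> f \<longlonglongrightarrow> c"
proof -
  assume "asymp0 f c"
  then have "(\<lambda>n. f n - c) \<in> O(\<lambda>n. 1 / real n)" by (simp add: asymp0_def)
  also have "(\<lambda>n. 1 / real n) \<in> o(\<lambda>_. 1)" by real_asymp
  finally have "(\<lambda>n. f n - c) \<longlonglongrightarrow> 0"
    using smalloD_tendsto by fastforce
  then show ?thesis by (simp add: LIM_zero_iff)
qed

text \<open>\<open>f n * (1 - d / n)\<close> is \<open>1 + O(n^(-2))\<close>, and dividing by
  \<open>f n\<close>, which tends to \<open>1\<close>, preserves the error.\<close>

lemma asymp1_recip:
  assumes f: "asymp1 f 1 d"
  shows "asymp1 (\<lambda>n. 1 / f n) 1 (- d)"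
proof -
  have lim: "f \<longlonglongrightarrow> 1" by (intro asymp0_tendsto asymp1_imp_asymp0[OF f])
  then have inv: "(\<lambda>n. 1 / f n) \<in> O(\<lambda>_. 1)"
    by (intro bigoI_tendsto[where c = 1]) (auto intro!: tendsto_eq_intros)
  have pos: "eventually (\<lambda>n. f n > 0) sequentially"
    using order_tendstoD(1)[OF lim, of 0] by simp
  have "asymp1 (\<lambda>n. f n * (1 + (- d) * (1 / real n))) (1 * (1 + (-d) * 0)) (1 * (0 + ((-d) * 1 + 0 * 0)) + d * (1 + (-d) * 0))"
    by (intro asymp1_mult f asymp1_add asymp1_const asymp1_inverse)
  then have "(\<lambda>n. f n * (1 + (- d) * (1 / real n)) - 1) \<in> O(\<lambda>n. 1 / (real n)\<^sup>2)"
    by (simp add: asymp1_def)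
  then have "(\<lambda>n. (f n * (1 + (- d) * (1 / real n)) - 1) * (1 / f n) * (- 1)) \<in> O(\<lambda>n. 1 / (real n)\<^sup>2)"
    by (intro bigo_mult_bounded inv) auto
  moreover have "eventually (\<lambda>n. (f n * (1 + (- d) * (1 / real n)) - 1) * (1 / f n) * (- 1)
      = 1 / f n - (1 + (- d) / real n)) sequentially"
    using pos by eventually_elim (simp add: field_simps)
  ultimately show ?thesis
    unfolding asymp1_def by (subst (asm) landau_o.big.in_cong)
qed

text \<open>Replacing \<open>d / (n - 1)\<close> by \<open>d / n\<close> costs only
  \<open>O(n^(-2))\<close>.\<close>

lemma asymp1_pred:
  assumes f: "asymp1 f c d"
  shows "asymp1 (\<lambda>n. f (n - 1)) c d"
proof -
  have "filterlim (\<lambda>n :: nat. n - 1) sequentially sequentially"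
    by real_asymp
  then have "(\<lambda>n. f (n - 1) - (c + d / real (n - 1))) \<in> O(\<lambda>n. 1 / (real (n - 1))\<^sup>2)"
    using landau_o.big.compose[OF f[unfolded asymp1_def]] by blast
  also have "(\<lambda>n. 1 / (real (n - 1))\<^sup>2) \<in> O(\<lambda>n. 1 / (real n)\<^sup>2)"
  proof -
    have "(\<lambda>n. 1 / (real n - 1)\<^sup>2) \<in> O(\<lambda>n. 1 / (real n)\<^sup>2)" by real_asymp
    moreover have "eventually (\<lambda>n. 1 / (real n - 1)\<^sup>2 = 1 / (real (n - 1))\<^sup>2) sequentially"
      using eventually_ge_at_top[of 1] by eventually_elim (simp add: of_nat_diff)
    ultimately show ?thesis by (subst (asm) landau_o.big.in_cong)
  qed
  finally have 1: "(\<lambda>n. f (n - 1) - (c + d / real (n - 1))) \<in> O(\<lambda>n. 1 / (real n)\<^sup>2)" .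
  have 2: "(\<lambda>n. 1 / real (n - 1) - 1 / real n) \<in> O(\<lambda>n. 1 / (real n)\<^sup>2)"
  proof -
    have "(\<lambda>n. 1 / (real n - 1) - 1 / real n) \<in> O(\<lambda>n. 1 / (real n)\<^sup>2)" by real_asymp
    moreover have "eventually (\<lambda>n. 1 / (real n - 1) - 1 / real n = 1 / real (n - 1) - 1 / real n) sequentially"
      using eventually_ge_at_top[of 1] by eventually_elim (simp add: of_nat_diff)
    ultimately show ?thesis by (subst (asm) landau_o.big.in_cong)
  qed
  have "(\<lambda>n. (f (n - 1) - (c + d / real (n - 1))) + (1 / real (n - 1) - 1 / real n) * d) \<in> O(\<lambda>n. 1 / (real n)\<^sup>2)"
    by (intro sum_in_bigo(1)[OF 1] bigo_mult_bounded[OF 2]) simp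
  then show ?thesis
    unfolding asymp1_def by (simp add: algebra_simps)
qed

lemma asymp1_powr_shift:
  "asymp1 (\<lambda>n. real (Suc n) powr s / real n powr s) 1 s"
proof -
  have "(\<lambda>n. (1 + 1 / real n) powr s - (1 + s / real n)) \<in> O(\<lambda>n. 1 / (real n)\<^sup>2)"
    by real_asymp
  then have "asymp1 (\<lambda>n. (1 + 1 / real n) powr s) 1 s" by (simp add: asymp1_def)
  then show ?thesis
  proof (rule asymp1_cong)
    show "\<forall>\<^sub>F n in sequentially. (1 + 1 / real n) powr s = real (Suc n) powr s / real n powr s"
      using eventually_gt_at_top[of 0]
      by eventually_elim (simp add: powr_divide[symmetric] add_divide_distrib add.commute)
  qed simp_all
qed

lemma asymp1_powr_pred:
  "asymp1 (\<lambda>n. real (n - 1) powr s / real n powr s) 1 (- s)"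
proof -
  have "(\<lambda>n. (1 - 1 / real n) powr s - (1 - s / real n)) \<in> O(\<lambda>n. 1 / (real n)\<^sup>2)"
    by real_asymp
  then have "asymp1 (\<lambda>n. (1 - 1 / real n) powr s) 1 (- s)" by (simp add: asymp1_def)
  then show ?thesis
  proof (rule asymp1_cong)
    show "\<forall>\<^sub>F n in sequentially. (1 - 1 / real n) powr s = real (n - 1) powr s / real n powr s"
      using eventually_gt_at_top[of 0]
      by eventually_elim (simp add: powr_divide[symmetric] diff_divide_distrib of_nat_diff)
  qed simp_all
qed

section \<open>Asymptotics of the weight and of the energy coefficients\<close>

text \<open>The leading terms cancel as \<open>2 - 1 - 1\<close>; the \<open>1/n\<close> terms are
  \<open>2 \<beta>\<close> from \<open>b\<close>, \<open>-\<alpha>\<close> from \<open>a n\<close>,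
  and \<open>-\<alpha> + \<sigma>\<close> from the preceding coefficient, whose power is
  shifted.\<close>

lemma asymp1_jweight:
  assumes a: "asymp1 (\<lambda>n. a n / real n powr \<sigma>) 1 \<alpha>"
    and b: "asymp1 (\<lambda>n. b n / (2 * g * real n powr \<sigma>)) 1 \<beta>" and g: "\<bar>g\<bar> = 1"
  shows "asymp1 (\<lambda>n. jweight a b g n / real n powr \<sigma>) 0 (2 * \<beta> - 2 * \<alpha> + \<sigma>)"
proof -
  have g': "g = 1 \<or> g = - 1" using g by linarith
  have "asymp1 (\<lambda>n. 2 * (b n / (2 * g * real n powr \<sigma>))
      + ((- 1) * (a n / real n powr \<sigma>)
      + (- 1) * (a (n - 1) / real (n - 1) powr \<sigma> * (real (n - 1) powr \<sigma> / real n powr \<sigma>))))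
    (2 * 1 + ((- 1) * 1 + (- 1) * (1 * 1)))
    ((2 * \<beta> + 0 * 1) + (((- 1) * \<alpha> + 0 * 1) + ((- 1) * (1 * (- \<sigma>) + \<alpha> * 1) + 0 * (1 * 1))))"
    by (intro asymp1_add asymp1_mult[OF asymp1_const] b a asymp1_mult[OF asymp1_pred[OF a] asymp1_powr_pred])
  then show ?thesis
  proof (rule asymp1_cong)
    show "\<forall>\<^sub>F n in sequentially. 2 * (b n / (2 * g * real n powr \<sigma>))
      + ((- 1) * (a n / real n powr \<sigma>)
      + (- 1) * (a (n - 1) / real (n - 1) powr \<sigma> * (real (n - 1) powr \<sigma> / real n powr \<sigma>)))
      = jweight a b g n / real n powr \<sigma>"
      using eventually_gt_at_top[of 1]
    proof eventually_elim
      \<comment> \<open>From \<open>n = 2\<close> on, \<open>n - 1\<close> is positive, so its power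
        cancels and the boundary case of \<open>jweight\<close> does not occur.\<close>
      case (elim n)
      have "b n / (g * real n powr \<sigma>) = g * b n / real n powr \<sigma>"
        using g' by auto
      with elim show ?case
        by (simp add: jweight_def diff_divide_distrib)
    qed
  qed simp_all
qed

text \<open>The weight is \<open>n powr (\<sigma> - 1)\<close> times a factor tending to
  \<open>\<tau>\<close>.\<close>

lemma jweight_at_top:
  assumes w: "asymp1 (\<lambda>n. jweight a b g n / real n powr \<sigma>) 0 \<tau>" and \<sigma>: "\<sigma> > 1" and \<tau>: "\<tau> > 0"
  shows "filterlim (jweight a b g) at_top sequentially"
proof -
  have w0: "asymp0 (\<lambda>n. real n * (jweight a b g n / real n powr \<sigma>)) \<tau>"
    using asymp1_times_n[OF w] .
  have "filterlim (\<lambda>n. real n * (jweight a b g n / real n powr \<sigma>) * real n powr (\<sigma> - 1)) at_top sequentially"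
    using \<sigma> by (intro filterlim_tendsto_pos_mult_at_top[OF asymp0_tendsto[OF w0] \<tau>]) real_asymp
  moreover have "\<forall>\<^sub>F n in sequentially. real n * (jweight a b g n / real n powr \<sigma>) * real n powr (\<sigma> - 1) = jweight a b g n"
    using eventually_gt_at_top[of 0]
    by eventually_elim (simp add: powr_diff)
  ultimately show ?thesis
    by (rule filterlim_cong[THEN iffD1, OF refl refl, rotated])
qed

text \<open>The middle coefficient \<open>s - \<kappa>\<close> is what makes the terms of relative order \<open>1/n\<close> cancel in both
  diagonal entries; the remaining errors are of relative order \<open>n powr (-3/2)\<close>, which is summable.\<close>

lemma qform_coefficients:
  fixes \<kappa> s :: real and r v :: "nat \<Rightarrow> real"
  assumes \<kappa>: "\<kappa> > 0" and s: "s > 1"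
    and r: "asymp1 (\<lambda>n. r n * real n powr (s + 1/2)) 1 \<alpha>"
    and v: "asymp1 (\<lambda>n. v n / real n powr (s + 1/2)) 0 (- \<kappa>)"
  defines "\<rho> \<equiv> min (3/2) s" and "A \<equiv> \<lambda>n. \<kappa> * real n powr s"
    and "B \<equiv> \<lambda>n. (s - \<kappa>) * real n powr (- 1/2)" and "C \<equiv> \<lambda>n. real n powr (- s)"
  shows "\<exists>K>0. \<forall>\<^sub>F n in sequentially.
      \<bar>A (Suc n) * (1 + r n * v n)\<^sup>2 + B (Suc n) * (v n * (1 + r n * v n)) + C (Suc n) * (v n)\<^sup>2 - A n\<bar>
        \<le> (K * real n powr (- \<rho>)) * A n
    \<and> \<bar>2 * A (Suc n) * r n * (1 + r n * v n) + B (Suc n) * (1 + 2 * (r n * v n)) + 2 * C (Suc n) * v n - B n\<bar>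
        \<le> K * real n powr (- \<rho>)
    \<and> \<bar>A (Suc n) * (r n)\<^sup>2 + B (Suc n) * r n + C (Suc n) - C n\<bar> \<le> (K * real n powr (- \<rho>)) * C n"
proof -
  \<comment> \<open>All powers of \<open>n\<close> are scaled out here, leaving factors with finite
    limits to which the expansion calculus applies.\<close>
  define R V where "R n = r n * real n powr (s + 1/2)" and "V n = v n / real n powr (s + 1/2)" for n
  define SA SB SC where "SA n = real (Suc n) powr s / real n powr s"
    and "SB n = real (Suc n) powr (- 1/2) / real n powr (- 1/2)"
    and "SC n = real (Suc n) powr (- s) / real n powr (- s)" for n
  have R: "asymp1 R 1 \<alpha>" and V: "asymp1 V 0 (- \<kappa>)"
    using r v by (simp_all add: R_def[abs_def] V_def[abs_def])
  have SA: "asymp1 SA 1 s" and SB: "asymp1 SB 1 (- 1/2)" and SC: "asymp1 SC 1 (- s)"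
    unfolding SA_def SB_def SC_def by (rule asymp1_powr_shift)+
  have RV: "asymp1 (\<lambda>n. R n * V n) 0 (- \<kappa>)"
    using asymp1_mult[OF R V] by simp
  have RV1: "asymp1 (\<lambda>n. 1 + R n * V n) 1 (- \<kappa>)"
    using asymp1_add[OF asymp1_const RV, of 1] by simp
  have nV: "asymp0 (\<lambda>n. real n * V n) (- \<kappa>)"
    by (rule asymp1_times_n[OF V])
  note SA0 = asymp1_imp_asymp0[OF SA] and SB0 = asymp1_imp_asymp0[OF SB] and SC0 = asymp1_imp_asymp0[OF SC]
    and R0 = asymp1_imp_asymp0[OF R] and RV0 = asymp1_imp_asymp0[OF RV] and RV10 = asymp1_imp_asymp0[OF RV1]
  \<comment> \<open>The \<open>1/n\<close> contributions are \<open>s - 2 \<kappa>\<close>,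
    \<open>-(s - \<kappa>)\<close> and \<open>\<kappa>\<close>, which add up to zero.\<close>
  have P: "asymp1 (\<lambda>n. SA n * ((1 + R n * V n) * (1 + R n * V n))
      + ((s - \<kappa>) / \<kappa> * (V n * (SB n * (1 + R n * V n))) + 1 / \<kappa> * (V n * (SC n * (real n * V n))))) 1 0"
    by (rule asymp1_cong[OF asymp1_add[OF asymp1_mult[OF SA asymp1_mult[OF RV1 RV1]]
          asymp1_add[OF asymp1_mult[OF asymp1_const[of "(s - \<kappa>) / \<kappa>"]
              asymp1_mult_asymp0[OF V asymp0_mult[OF SB0 RV10]]]
            asymp1_mult[OF asymp1_const[of "1 / \<kappa>"] asymp1_mult_asymp0[OF V asymp0_mult[OF SC0 nV]]]]]])
      (use \<kappa> in \<open>simp_all add: field_simps\<close>)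
  \<comment> \<open>Here the \<open>1/n\<close> contributions are \<open>\<kappa>\<close>,
    \<open>s - \<kappa>\<close> and \<open>- s\<close>.\<close>
  have Q: "asymp1 (\<lambda>n. \<kappa> * (1 / real n * (SA n * (R n * R n))) + ((s - \<kappa>) * (1 / real n * (SB n * R n)) + SC n)) 1 0"
    by (rule asymp1_cong[OF asymp1_add[OF
          asymp1_mult[OF asymp1_const[of \<kappa>] asymp1_mult_asymp0[OF asymp1_inverse asymp0_mult[OF SA0 asymp0_mult[OF R0 R0]]]]
          asymp1_add[OF asymp1_mult[OF asymp1_const[of "s - \<kappa>"]
              asymp1_mult_asymp0[OF asymp1_inverse asymp0_mult[OF SB0 R0]]] SC]]])
      simp_all
  \<comment> \<open>The limits \<open>2 \<kappa>\<close>, \<open>s - \<kappa>\<close>,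
    \<open>-2 \<kappa>\<close> and \<open>-(s - \<kappa>)\<close> cancel.\<close>
  have X: "asymp0 (\<lambda>n. 2 * \<kappa> * (SA n * (R n * (1 + R n * V n)))
      + ((s - \<kappa>) * (SB n * (1 + 2 * (R n * V n))) + (2 * (SC n * (real n * V n)) + (- (s - \<kappa>))))) 0"
    by (rule asymp0_cong[OF asymp0_add[OF
          asymp0_mult[OF asymp0_const[of "2 * \<kappa>"] asymp0_mult[OF SA0 asymp0_mult[OF R0 RV10]]]
          asymp0_add[OF asymp0_mult[OF asymp0_const[of "s - \<kappa>"] asymp0_mult[OF SB0
                asymp0_add[OF asymp0_const[of 1] asymp0_mult[OF asymp0_const[of 2] RV0]]]]
            asymp0_add[OF asymp0_mult[OF asymp0_const[of 2] asymp0_mult[OF SC0 nV]]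
              asymp0_const[of "- (s - \<kappa>)"]]]]])
      simp_all
  have small: "(\<lambda>n. real n powr (- 3/2)) \<in> O(\<lambda>n. real n powr (- \<rho>))"
  proof (rule bigoI[of _ 1])
    show "\<forall>\<^sub>F n in sequentially. norm (real n powr (- 3/2)) \<le> 1 * norm (real n powr (- \<rho>))"
      using eventually_ge_at_top[of 1] by eventually_elim (simp add: \<rho>_def powr_mono)
  qed
  have small1: "(\<lambda>n. 1 / (real n)\<^sup>2) \<in> O(\<lambda>n. real n powr (- \<rho>))"
  proof -
    have "(\<lambda>n. 1 / (real n)\<^sup>2) \<in> O(\<lambda>n. real n powr (- 3/2))" by real_asymp
    also note small
    finally show ?thesis .
  qed
  have small0: "(\<lambda>n. real n powr (- 1/2) * (1 / real n)) \<in> O(\<lambda>n. real n powr (- \<rho>))"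
  proof -
    have "(\<lambda>n. real n powr (- 1/2) * (1 / real n)) \<in> O(\<lambda>n. real n powr (- 3/2))" by real_asymp
    also note small
    finally show ?thesis .
  qed
  define FP FQ FX where "FP n = SA n * ((1 + R n * V n) * (1 + R n * V n))
      + ((s - \<kappa>) / \<kappa> * (V n * (SB n * (1 + R n * V n))) + 1 / \<kappa> * (V n * (SC n * (real n * V n)))) - 1"
    and "FQ n = \<kappa> * (1 / real n * (SA n * (R n * R n))) + ((s - \<kappa>) * (1 / real n * (SB n * R n)) + SC n) - 1"
    and "FX n = real n powr (- 1/2) * (2 * \<kappa> * (SA n * (R n * (1 + R n * V n)))
      + ((s - \<kappa>) * (SB n * (1 + 2 * (R n * V n))) + (2 * (SC n * (real n * V n)) + (- (s - \<kappa>)))))" for n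
  have "FP \<in> O(\<lambda>n. real n powr (- \<rho>))"
    using landau_o.big_trans[OF P[unfolded asymp1_def] small1] by (simp add: FP_def[abs_def])
  then obtain K1 where K1: "K1 > 0" "\<forall>\<^sub>F n in sequentially. \<bar>FP n\<bar> \<le> K1 * real n powr (- \<rho>)"
    by (elim landau_o.bigE) auto
  have "FQ \<in> O(\<lambda>n. real n powr (- \<rho>))"
    using landau_o.big_trans[OF Q[unfolded asymp1_def] small1] by (simp add: FQ_def[abs_def])
  then obtain K2 where K2: "K2 > 0" "\<forall>\<^sub>F n in sequentially. \<bar>FQ n\<bar> \<le> K2 * real n powr (- \<rho>)"
    by (elim landau_o.bigE) auto
  have "FX \<in> O(\<lambda>n. real n powr (- \<rho>))"
    using landau_o.big_trans[OF landau_o.big.mult_left[OF X[unfolded asymp0_def], of "\<lambda>n. real n powr (- 1/2)"] small0]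
    by (simp add: FX_def[abs_def])
  then obtain K3 where K3: "K3 > 0" "\<forall>\<^sub>F n in sequentially. \<bar>FX n\<bar> \<le> K3 * real n powr (- \<rho>)"
    by (elim landau_o.bigE) auto
  define K where "K = max K1 (max K2 K3)"
  have "K > 0" using K1(1) by (simp add: K_def)
  moreover have "\<forall>\<^sub>F n in sequentially.
      \<bar>A (Suc n) * (1 + r n * v n)\<^sup>2 + B (Suc n) * (v n * (1 + r n * v n)) + C (Suc n) * (v n)\<^sup>2 - A n\<bar>
        \<le> (K * real n powr (- \<rho>)) * A n
    \<and> \<bar>2 * A (Suc n) * r n * (1 + r n * v n) + B (Suc n) * (1 + 2 * (r n * v n)) + 2 * C (Suc n) * v n - B n\<bar>
        \<le> K * real n powr (- \<rho>)
    \<and> \<bar>A (Suc n) * (r n)\<^sup>2 + B (Suc n) * r n + C (Suc n) - C n\<bar> \<le> (K * real n powr (- \<rho>)) * C n"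
    using K1(2) K2(2) K3(2) eventually_gt_at_top[of 0]
  proof eventually_elim
    case (elim n)
    \<comment> \<open>In terms of \<open>x\<close> and \<open>y\<close> the remaining comparison
      with \<open>FP\<close>, \<open>FX\<close> and \<open>FQ\<close> consists of rational
      identities.\<close>
    define x where "x = real n powr (- 1/2)"
    define y where "y = real n powr s"
    have n: "real n > 0" and xy: "x > 0" "y > 0" using elim by (simp_all add: x_def y_def)
    have xx: "real n = 1 / (x * x)"
    proof -
      have "x * x = real n powr (- 1)" unfolding x_def powr_add[symmetric] by simp
      then show ?thesis using n by (simp add: powr_minus_divide)
    qed
    have pw: "real n powr (s + 1/2) = y / x"
      unfolding x_def y_def by (simp add: powr_add powr_minus_divide)
    have rn: "r n = R n * x / y" and vn: "v n = V n * y / x"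
      using xy by (simp_all add: R_def V_def pw)
    have An: "A n = \<kappa> * y" and A1: "A (Suc n) = \<kappa> * (SA n * y)"
      using xy by (simp_all add: A_def SA_def y_def)
    have Bn: "B n = (s - \<kappa>) * x" and B1: "B (Suc n) = (s - \<kappa>) * (SB n * x)"
      using xy by (simp_all add: B_def SB_def x_def)
    have Cn: "C n = 1 / y" and C1: "C (Suc n) = SC n / y"
      using xy by (simp_all add: C_def SC_def y_def powr_minus_divide)
    have rv: "r n * v n = R n * V n" using xy by (simp add: rn vn)
    have eP: "A (Suc n) * (1 + r n * v n)\<^sup>2 + B (Suc n) * (v n * (1 + r n * v n)) + C (Suc n) * (v n)\<^sup>2 - A n
        = FP n * A n"
    proof -
      have "\<kappa> * (a * y) * w\<^sup>2 + (s - \<kappa>) * (b * x) * (u * y / x * w) + c / y * (u * y / x)\<^sup>2 - \<kappa> * y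
          = (a * (w * w) + ((s - \<kappa>) / \<kappa> * (u * (b * w)) + 1 / \<kappa> * (u * (c * (1 / (x * x) * u)))) - 1) * (\<kappa> * y)"
        for a b c u w
      proof -
        have "(s - \<kappa>) * (b * x) * (u * y / x * w) = (s - \<kappa>) * b * u * w * y"
          and "(s - \<kappa>) / \<kappa> * (u * (b * w)) * (\<kappa> * y) = (s - \<kappa>) * b * u * w * y"
          and "c / y * (u * y / x)\<^sup>2 = c * u * u * y / (x * x)"
          and "1 / \<kappa> * (u * (c * (1 / (x * x) * u))) * (\<kappa> * y) = c * u * u * y / (x * x)"
          using xy \<kappa> by (simp_all add: power2_eq_square)
        moreover have "\<kappa> * (a * y) * w\<^sup>2 = a * (w * w) * (\<kappa> * y)"
          by (simp add: power2_eq_square)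
        ultimately show ?thesis
          by (simp only: distrib_right left_diff_distrib mult_1 add.assoc)
      qed
      then show ?thesis
        unfolding rv unfolding A1 B1 C1 An vn FP_def xx .
    qed
    have eX: "2 * A (Suc n) * r n * (1 + r n * v n) + B (Suc n) * (1 + 2 * (r n * v n)) + 2 * C (Suc n) * v n - B n
        = FX n"
    proof -
      have "2 * (\<kappa> * (a * y)) * (R n * x / y) * w + (s - \<kappa>) * (b * x) * w' + 2 * (c / y) * (u * y / x) - (s - \<kappa>) * x
          = x * (2 * \<kappa> * (a * (R n * w)) + ((s - \<kappa>) * (b * w') + (2 * (c * (1 / (x * x) * u)) + (- (s - \<kappa>)))))"
        for a b c u w w'
        using xy by (simp add: divide_simps) algebra
      then show ?thesis
        unfolding FX_def x_def[symmetric] rv unfolding A1 B1 C1 Bn vn rn xx .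
    qed
    have eQ: "A (Suc n) * (r n)\<^sup>2 + B (Suc n) * r n + C (Suc n) - C n = FQ n * C n"
    proof -
      have "\<kappa> * (a * y) * (u * x / y)\<^sup>2 + (s - \<kappa>) * (b * x) * (u * x / y) + c / y - 1 / y
          = (\<kappa> * (1 / (1 / (x * x)) * (a * (u * u))) + ((s - \<kappa>) * (1 / (1 / (x * x)) * (b * u)) + c) - 1) * (1 / y)"
        for a b c u
        using xy by (simp add: divide_simps power2_eq_square)
      then show ?thesis
        unfolding A1 B1 C1 Cn rn FQ_def xx .
    qed
    have le: "K1 * real n powr (- \<rho>) \<le> K * real n powr (- \<rho>)" "K2 * real n powr (- \<rho>) \<le> K * real n powr (- \<rho>)"
      "K3 * real n powr (- \<rho>) \<le> K * real n powr (- \<rho>)"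
      by (intro mult_right_mono; simp add: K_def)+
    have "\<bar>FP n * A n\<bar> \<le> (K * real n powr (- \<rho>)) * A n"
      unfolding abs_mult using elim(1) le(1) \<kappa> xy by (intro mult_mono) (auto simp: An)
    moreover have "\<bar>FQ n * C n\<bar> \<le> (K * real n powr (- \<rho>)) * C n"
      unfolding abs_mult using elim(2) le(2) xy by (intro mult_mono) (auto simp: Cn)
    moreover have "\<bar>FX n\<bar> \<le> K * real n powr (- \<rho>)"
      using elim(3) le(3) by linarith
    ultimately show ?case
      unfolding eP eX eQ by blast
  qed
  ultimately show ?thesis by blast
qed

subsection \<open>Square summability of the solutions\<close>

text \<open>Packages the energy of the twisted sequence and its flux along any sequence
  \<open>x\<close>, with \<open>jac a b x\<close> acting as forcing. \<open>N\<close>,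
  \<open>K\<close> and \<open>M\<close> do not depend on \<open>x\<close>, which later gives
  estimates uniform over the maximal domain.\<close>

lemma qform_jacobi:
  assumes a: "\<And>n. a n > 0" and g: "\<bar>g\<bar> = 1" and \<kappa>: "\<kappa> > 0" and s: "s > 1"
    and a_asymp: "asymp1 (\<lambda>n. a n / real n powr (s + 1/2)) 1 \<alpha>"
    and w_asymp: "asymp1 (\<lambda>n. jweight a b g n / real n powr (s + 1/2)) 0 (- \<kappa>)"
  obtains N K and E :: "(nat \<Rightarrow> complex) \<Rightarrow> nat \<Rightarrow> real" and M
    where "N > 0" "K \<ge> 0"
    and "\<And>x n. n \<ge> N \<Longrightarrow> E x (Suc n) \<le> (1 + K * real n powr (- min (3/2) s)) * E x n + K * (cmod (jac a b x n))\<^sup>2"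
    and "\<And>x n. n \<ge> N \<Longrightarrow> \<kappa> * real n powr s * (cmod (x n))\<^sup>2 \<le> 2 * E x n"
    and "M \<ge> 0" "\<And>x c. (\<And>n. cmod (x n) \<le> c) \<Longrightarrow> E x N \<le> M * c\<^sup>2"
proof -
  \<comment> \<open>At most \<open>3/2\<close> because of the coefficient errors and at most
    \<open>s\<close> because of the forcing term; it still exceeds \<open>1\<close>, so the errors
    are summable.\<close>
  define \<rho> where "\<rho> = min (3/2) s"
  define A B C where "A n = \<kappa> * real n powr s" and "B n = (s - \<kappa>) * real n powr (- 1/2)"
    and "C n = real n powr (- s)" for n :: nat
  define r where "r n = 1 / a n" for n
  have r_asymp: "asymp1 (\<lambda>n. r n * real n powr (s + 1/2)) 1 (- \<alpha>)"
    using asymp1_recip[OF a_asymp] by (simp add: r_def)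
  define w where "w = jweight a b g"
  define small_step where "small_step e n \<longleftrightarrow>
      \<bar>A (Suc n) * (1 + r n * w n)\<^sup>2 + B (Suc n) * (w n * (1 + r n * w n)) + C (Suc n) * (w n)\<^sup>2 - A n\<bar> \<le> e * A n
    \<and> \<bar>2 * A (Suc n) * r n * (1 + r n * w n) + B (Suc n) * (1 + 2 * (r n * w n)) + 2 * C (Suc n) * w n - B n\<bar> \<le> e
    \<and> \<bar>A (Suc n) * (r n)\<^sup>2 + B (Suc n) * r n + C (Suc n) - C n\<bar> \<le> e * C n" for e n
  obtain K where K: "K > 0" and coeffs: "\<forall>\<^sub>F n in sequentially. small_step (K * real n powr (- \<rho>)) n"
    using qform_coefficients[OF \<kappa> s r_asymp w_asymp]
    unfolding small_step_def A_def B_def C_def \<rho>_def w_def by blast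
  have \<rho>: "\<rho> > 1" "\<rho> \<le> s" using s by (simp_all add: \<rho>_def)
  have "((\<lambda>n. K * real n powr (- \<rho>)) \<longlongrightarrow> 0) sequentially"
    using \<rho>(1) by real_asymp
  then have "\<forall>\<^sub>F n in sequentially. K * real n powr (- \<rho>) < 1"
    by (rule order_tendstoD) simp
  moreover have "((\<lambda>n. \<bar>(s - \<kappa>) * real n powr (- 1/2)\<bar>) \<longlongrightarrow> \<bar>(s - \<kappa>) * 0\<bar>) sequentially"
    by (intro tendsto_intros) real_asymp
  then have "\<forall>\<^sub>F n in sequentially. \<bar>B n\<bar> < sqrt \<kappa>"
    unfolding B_def by (rule order_tendstoD) (simp add: \<kappa>)
  ultimately have "\<forall>\<^sub>F n in sequentially. K * real n powr (- \<rho>) < 1 \<and> \<bar>B n\<bar> < sqrt \<kappa>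
      \<and> small_step (K * real n powr (- \<rho>)) n"
    using coeffs by eventually_elim simp
  then obtain N0 where N0: "\<And>n. n \<ge> N0 \<Longrightarrow> K * real n powr (- \<rho>) < 1 \<and> \<bar>B n\<bar> < sqrt \<kappa>
      \<and> small_step (K * real n powr (- \<rho>)) n"
    unfolding eventually_sequentially by blast
  \<comment> \<open>The successor makes \<open>N\<close> positive, and the flux at \<open>N\<close>
    then involves \<open>a N0\<close>, which enters the initial bound.\<close>
  define N where "N = Suc N0"
  define E where "E x n = qform (A n) (B n) (C n) (twist g x n) (flux a g x n)" for x n
  \<comment> \<open>One constant for both the growth factor of \<open>qform_step\<close> and the
    forcing factor \<open>4 * C n / e\<close>.\<close>
  define K' where "K' = max ((5 + 2 / sqrt \<kappa>) * K) (4 / K)"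
  have pos: "A n > 0" "C n > 0" "A n * C n = \<kappa>" "\<bar>B n\<bar> \<le> sqrt \<kappa>" if "n \<ge> N" for n
    using that N0[of n] \<kappa> by (auto simp: A_def C_def N_def powr_minus field_simps)
  have "E x (Suc n) \<le> (1 + K' * real n powr (- \<rho>)) * E x n + K' * (cmod (jac a b x n))\<^sup>2" if n: "n \<ge> N" for x n
  proof -
    define e where "e = K * real n powr (- \<rho>)"
    define h where "h = - (g *\<^sub>R twist g (jac a b x) n)"
    have n0: "n \<ge> N0" "Suc n \<ge> N" "real n \<ge> 1" using n by (auto simp: N_def)
    have e: "0 < e" "e \<le> 1"
      using N0[OF n0(1)] K n0(3) by (auto simp: e_def)
    have "E x (Suc n) \<le> (1 + (5 + 2 / sqrt \<kappa>) * e) * E x n + 4 * C n / e * inner h h"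
      unfolding E_def
    proof (rule qform_step[where r = "r n" and v = "w n", OF pos[OF n] pos[OF n0(2)] e])
      show "flux a g x (Suc n) = flux a g x n + w n *\<^sub>R twist g x n + h"
        by (simp add: flux_Suc[OF g] h_def w_def)
      show "twist g x (Suc n) = twist g x n + r n *\<^sub>R flux a g x (Suc n)"
        unfolding r_def using a[of n] by (intro twist_Suc) simp
    qed (use N0[OF n0(1)] in \<open>simp_all add: small_step_def e_def\<close>)
    also have "\<dots> \<le> (1 + K' * real n powr (- \<rho>)) * E x n + K' * (cmod (jac a b x n))\<^sup>2"
    proof (rule add_mono)
      have "(5 + 2 / sqrt \<kappa>) * e \<le> K' * real n powr (- \<rho>)"
        unfolding e_def K'_def by (subst mult.assoc[symmetric]) (intro mult_right_mono, auto)
      then show "(1 + (5 + 2 / sqrt \<kappa>) * e) * E x n \<le> (1 + K' * real n powr (- \<rho>)) * E x n"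
        unfolding E_def using qform_nonneg[OF pos[OF n]] by (intro mult_right_mono) auto
      \<comment> \<open>Here \<open>\<rho> \<le> s\<close> keeps the forcing factor bounded.\<close>
      have "C n / e = 1 / K * real n powr (\<rho> - s)"
        using n0(3) K by (simp add: C_def e_def powr_diff powr_minus field_simps)
      also have "\<dots> \<le> 1 / K * 1"
        using n0(3) K \<rho> powr_mono[of "\<rho> - s" 0 "real n"] by (intro mult_left_mono) auto
      finally have "4 * C n / e \<le> K'" by (simp add: K'_def)
      moreover have "inner h h = (cmod (jac a b x n))\<^sup>2"
        by (simp add: h_def power2_norm_eq_inner[symmetric] norm_mult norm_twist[OF g] g power_mult_distrib)
      ultimately show "4 * C n / e * inner h h \<le> K' * (cmod (jac a b x n))\<^sup>2"
        by (metis mult_right_mono zero_le_power2)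
    qed
    finally show ?thesis .
  qed
  moreover have "\<kappa> * real n powr s * (cmod (x n))\<^sup>2 \<le> 2 * E x n" if n: "n \<ge> N" for x n
  proof -
    have "A n * (cmod (twist g x n))\<^sup>2 + C n * (cmod (flux a g x n))\<^sup>2 \<le> 2 * E x n"
      using qform_ge_half(3)[OF pos[OF n]] unfolding E_def power2_norm_eq_inner .
    moreover have "C n * (cmod (flux a g x n))\<^sup>2 \<ge> 0" using pos(2)[OF n] by simp
    ultimately show ?thesis by (simp add: A_def norm_twist[OF g])
  qed
  moreover have "E x N \<le> (A N + \<bar>B N\<bar> * (2 * a N0) + C N * (2 * a N0)\<^sup>2) * c\<^sup>2"
    if x: "\<And>n. cmod (x n) \<le> c" for x c
  proof -
    let ?p = "twist g x N" and ?q = "flux a g x N"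
    have c: "c \<ge> 0" using x[of 0] norm_ge_zero order_trans by blast
    have p: "norm ?p \<le> c" by (simp add: norm_twist[OF g] x)
    have "norm ?q = a N0 * norm (twist g x N - twist g x N0)"
      using a[of N0] by (simp add: flux_def N_def)
    also have "\<dots> \<le> a N0 * (norm (twist g x N) + norm (twist g x N0))"
      using a[of N0] by (intro mult_left_mono norm_triangle_ineq4) simp
    also have "\<dots> \<le> a N0 * (c + c)"
      unfolding norm_twist[OF g] using a[of N0] by (intro mult_left_mono add_mono x) simp
    finally have q: "norm ?q \<le> 2 * a N0 * c" by simp
    have "A N * inner ?p ?p \<le> A N * c\<^sup>2"
      unfolding power2_norm_eq_inner[symmetric] using pos(1)[of N] p by (intro mult_left_mono power_mono) auto
    moreover have "C N * inner ?q ?q \<le> C N * (2 * a N0 * c)\<^sup>2"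
      unfolding power2_norm_eq_inner[symmetric] using pos(2)[of N] q by (intro mult_left_mono power_mono) auto
    moreover have "B N * inner ?p ?q \<le> \<bar>B N\<bar> * (c * (2 * a N0 * c))"
    proof -
      have "B N * inner ?p ?q \<le> \<bar>B N\<bar> * \<bar>inner ?p ?q\<bar>"
        by (metis abs_ge_self abs_mult)
      also have "\<dots> \<le> \<bar>B N\<bar> * (norm ?p * norm ?q)"
        by (intro mult_left_mono Cauchy_Schwarz_ineq2) simp
      also have "\<dots> \<le> \<bar>B N\<bar> * (c * (2 * a N0 * c))"
        using c by (intro mult_left_mono mult_mono p q) auto
      finally show ?thesis .
    qed
    ultimately show ?thesis
      unfolding E_def qform_def by (simp add: power2_eq_square algebra_simps)
  qed
  moreover have "N > 0" by (simp add: N_def)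
  moreover have "K' \<ge> 0" using K by (simp add: K'_def le_max_iff_disj)
  moreover have "A N + \<bar>B N\<bar> * (2 * a N0) + C N * (2 * a N0)\<^sup>2 \<ge> 0"
    using pos(1,2)[of N] a[of N0] by (intro add_nonneg_nonneg mult_nonneg_nonneg) auto
  ultimately show thesis
    unfolding \<rho>_def using that by blast
qed

text \<open>Since \<open>n powr (-\<rho>)\<close> is summable, the Gronwall inequality bounds the
  energy, and coercivity gives squared moduli of order \<open>n powr (-s)\<close> with
  \<open>s > 1\<close>. For a pair in the maximal operator the forcing is square summable, so the
  bound depends on the norms of \<open>u\<close> and \<open>f\<close> alone.\<close>

lemma jacobi_limit_circle:
  assumes a: "\<And>n. a n > 0" and g: "\<bar>g\<bar> = 1" and \<kappa>: "\<kappa> > 0" and s: "s > 1"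
    and a_asymp: "asymp1 (\<lambda>n. a n / real n powr (s + 1/2)) 1 \<alpha>"
    and w_asymp: "asymp1 (\<lambda>n. jweight a b g n / real n powr (s + 1/2)) 0 (- \<kappa>)"
  shows "deficiency_indices (jacobi_min a b) = (1, 1)"
    and "self_adjoint A \<Longrightarrow> jacobi_min a b \<subseteq> A \<Longrightarrow> discrete_spectrum A"
proof -
  define \<rho> where "\<rho> = min (3/2) s"
  have \<rho>: "\<rho> > 1" "\<rho> \<le> s" using s by (simp_all add: \<rho>_def)
  obtain N K M and E :: "(nat \<Rightarrow> complex) \<Rightarrow> nat \<Rightarrow> real" where N: "N > 0" and K: "K \<ge> 0"
    and step: "\<And>x n. n \<ge> N \<Longrightarrow> E x (Suc n) \<le> (1 + K * real n powr (- \<rho>)) * E x n + K * (cmod (jac a b x n))\<^sup>2"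
    and coercive: "\<And>x n. n \<ge> N \<Longrightarrow> \<kappa> * real n powr s * (cmod (x n))\<^sup>2 \<le> 2 * E x n"
    and M: "M \<ge> 0" and init: "\<And>x c. (\<And>n. cmod (x n) \<le> c) \<Longrightarrow> E x N \<le> M * c\<^sup>2"
    using qform_jacobi[OF a g \<kappa> s a_asymp w_asymp] unfolding \<rho>_def by blast
  have E_nonneg: "E x n \<ge> 0" if "n \<ge> N" for x n
  proof -
    have "0 \<le> \<kappa> * real n powr s * (cmod (x n))\<^sup>2" using \<kappa> by simp
    with coercive[OF that, of x] show ?thesis by linarith
  qed
  have bound: "(cmod (x n))\<^sup>2 \<le> 2 / \<kappa> * E x n * real n powr (- s)" if "n \<ge> N" for x n
    using coercive[OF that, of x] \<kappa> N that by (simp add: powr_minus field_simps)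
  have summ: "summable (\<lambda>n. L * real n powr (- \<rho>))" for L
    using \<rho>(1) by (intro summable_mult) (simp add: summable_real_powr_iff)
  have summ_s: "summable (\<lambda>n. L * real n powr (- s))" for L
    using s by (intro summable_mult) (simp add: summable_real_powr_iff)
  \<comment> \<open>Taking the full series in the exponent makes the growth factor uniform in
    \<open>n\<close>.\<close>
  have growth: "E x n \<le> exp (\<Sum>k. L * real k powr (- \<rho>)) * (E x N + (\<Sum>k=N..<n. y k))"
    if L: "L \<ge> 0" and y: "\<And>k. y k \<ge> 0" and n: "n \<ge> N"
      and st: "\<And>n. n \<ge> N \<Longrightarrow> E x (Suc n) \<le> (1 + L * real n powr (- \<rho>)) * E x n + y n" for x y n L
  proof -
    have "E x n \<le> exp (\<Sum>k=N..<n. L * real k powr (- \<rho>)) * (E x N + (\<Sum>k=N..<n. y k))"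
      by (rule discrete_gronwall[where E = "E x" and y = y and \<epsilon> = "\<lambda>n. L * real n powr (- \<rho>)",
            OF st _ y E_nonneg n])
        (use L in auto)
    also have "\<dots> \<le> exp (\<Sum>k. L * real k powr (- \<rho>)) * (E x N + (\<Sum>k=N..<n. y k))"
      using L y E_nonneg[of N x]
      by (intro mult_right_mono iffD2[OF exp_le_cancel_iff] sum_le_suminf summ add_nonneg_nonneg sum_nonneg) auto
    finally show ?thesis .
  qed
  have sol: "summable (\<lambda>n. (cmod (x n))\<^sup>2)" if x: "\<And>n. jac a b x n = z * x n" for z x
  proof -
    define L where "L = K + K * (cmod z)\<^sup>2 * 2 / \<kappa>"
    have L: "L \<ge> 0" using K \<kappa> by (simp add: L_def)
    \<comment> \<open>\<open>z x\<close> is treated as a forcing term; it is harmless because \<open>\<rho> \<le> s\<close>.\<close>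
    have st: "E x (Suc n) \<le> (1 + L * real n powr (- \<rho>)) * E x n + 0" if n: "n \<ge> N" for n
    proof -
      have "(cmod (jac a b x n))\<^sup>2 = (cmod z)\<^sup>2 * (cmod (x n))\<^sup>2"
        by (simp add: x norm_mult power_mult_distrib)
      also have "\<dots> \<le> (cmod z)\<^sup>2 * (2 / \<kappa> * E x n * real n powr (- s))"
        by (intro mult_left_mono bound n) simp
      also have "\<dots> \<le> (cmod z)\<^sup>2 * (2 / \<kappa> * E x n * real n powr (- \<rho>))"
        using n N \<rho> \<kappa> E_nonneg[OF n] by (intro mult_left_mono powr_mono) auto
      finally have "K * (cmod (jac a b x n))\<^sup>2 \<le> K * ((cmod z)\<^sup>2 * (2 / \<kappa> * E x n * real n powr (- \<rho>)))"
        using K by (intro mult_left_mono)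
      with step[OF n, of x] show ?thesis
        by (simp add: L_def algebra_simps)
    qed
    define D where "D = 2 / \<kappa> * (exp (\<Sum>k. L * real k powr (- \<rho>)) * E x N)"
    show ?thesis
    proof (rule summable_comparison_test'[OF summ_s[of D], of N])
      fix n assume n: "N \<le> n"
      have "(cmod (x n))\<^sup>2 \<le> 2 / \<kappa> * E x n * real n powr (- s)"
        by (rule bound[OF n])
      also have "\<dots> \<le> D * real n powr (- s)"
        unfolding D_def using growth[OF L _ n st] \<kappa>
        by (intro mult_right_mono mult_left_mono) auto
      finally show "norm ((cmod (x n))\<^sup>2) \<le> D * real n powr (- s)" by simp
    qed
  qed
  \<comment> \<open>\<open>2 / \<kappa>\<close> comes from coercivity, the exponential from
    Gronwall, \<open>M\<close> from the initial energy and \<open>K\<close> from the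
    forcing.\<close>
  define D where "D = 2 / \<kappa> * (exp (\<Sum>k. K * real k powr (- \<rho>)) * (M + K))"
  define m where "m n = (if n < N then 1 else D * real n powr (- s))" for n
  have m: "summable m"
  proof (rule summable_cong[THEN iffD1, OF _ summ_s[of D]])
    show "\<forall>\<^sub>F n in sequentially. D * real n powr (- s) = m n"
      using eventually_ge_at_top[of N] by eventually_elim (simp add: m_def)
  qed
  have dom: "(cmod (coord u n))\<^sup>2 \<le> ((norm u)\<^sup>2 + (norm f)\<^sup>2) * m n" if uf: "(u, f) \<in> jacobi_max a b" for u f n
  proof (cases "n < N")
    case True
    have "(cmod (coord u n))\<^sup>2 \<le> (norm u)\<^sup>2 + (norm f)\<^sup>2"
      using sum_coord_le[of "{n}" u] by (simp add: add_increasing2)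
    with True show ?thesis by (simp add: m_def)
  next
    case False
    then have n: "n \<ge> N" by simp
    have f: "jac a b (coord u) n = coord f n" for n
      using uf by (simp add: jacobi_max_def)
    have "E (coord u) n \<le> exp (\<Sum>k. K * real k powr (- \<rho>)) *
        (E (coord u) N + (\<Sum>k=N..<n. K * (cmod (coord f k))\<^sup>2))"
      using step[of _ "coord u"] K unfolding f by (intro growth n) auto
    also have "\<dots> \<le> exp (\<Sum>k. K * real k powr (- \<rho>)) * (M * (norm u)\<^sup>2 + K * (norm f)\<^sup>2)"
      unfolding sum_distrib_left[symmetric] using K
      by (intro mult_left_mono add_mono init norm_coord_le sum_coord_le) auto
    also have "\<dots> \<le> exp (\<Sum>k. K * real k powr (- \<rho>)) * ((M + K) * ((norm u)\<^sup>2 + (norm f)\<^sup>2))"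
      using K M by (intro mult_left_mono) (auto simp: algebra_simps)
    finally have "2 / \<kappa> * E (coord u) n * real n powr (- s)
        \<le> 2 / \<kappa> * (exp (\<Sum>k. K * real k powr (- \<rho>)) * ((M + K) * ((norm u)\<^sup>2 + (norm f)\<^sup>2))) * real n powr (- s)"
      using \<kappa> by (intro mult_right_mono mult_left_mono) auto
    also have "\<dots> = ((norm u)\<^sup>2 + (norm f)\<^sup>2) * m n"
      using False by (simp add: m_def D_def)
    finally show ?thesis
      using bound[OF n, of "coord u"] by linarith
  qed
  have a0: "a n \<noteq> 0" for n using a[of n] by simp
  show "deficiency_indices (jacobi_min a b) = (1, 1)"
    by (rule limit_circle_discrete(1)[OF a0 sol m dom])
  show "self_adjoint A \<Longrightarrow> jacobi_min a b \<subseteq> A \<Longrightarrow> discrete_spectrum A"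
    by (rule limit_circle_discrete(2)[OF a0 sol m dom])
qed

theorem theorem2p3:
  fixes a b :: "nat \<Rightarrow> real" and \<alpha> \<beta> \<gamma> \<sigma> \<tau> :: real
  assumes a_pos: "\<And>n. a n > 0"
    and a_asymp: "(\<lambda>n. a n / real n powr \<sigma> - (1 + \<alpha> / real n)) \<in> O(\<lambda>n. 1 / (real n)\<^sup>2)"
    and b_asymp: "(\<lambda>n. b n / (2 * \<gamma> * real n powr \<sigma>) - (1 + \<beta> / real n)) \<in> O(\<lambda>n. 1 / (real n)\<^sup>2)"
    and gamma: "\<bar>\<gamma>\<bar> = 1"
    and sigma: "\<sigma> > 3 / 2"
    and tau: "\<tau> = 2 * \<beta> - 2 * \<alpha> + \<sigma>"
  shows "(\<tau> < 0 \<longrightarrow>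
            deficiency_indices (jacobi_min a b) = (1, 1) \<and>
            (\<forall>A. self_adjoint A \<and> jacobi_min a b \<subseteq> A \<longrightarrow> discrete_spectrum A)) \<and>
         (\<tau> > 0 \<longrightarrow>
            essentially_self_adjoint (jacobi_min a b) \<and>
            discrete_spectrum (closure (jacobi_min a b)) \<and>
            (\<gamma> = 1 \<longrightarrow> bdd_below (Re ` spectrum (closure (jacobi_min a b)))) \<and>
            (\<gamma> = - 1 \<longrightarrow> bdd_above (Re ` spectrum (closure (jacobi_min a b)))))"
proof (intro conjI impI)
  have a: "asymp1 (\<lambda>n. a n / real n powr \<sigma>) 1 \<alpha>"
    and b: "asymp1 (\<lambda>n. b n / (2 * \<gamma> * real n powr \<sigma>)) 1 \<beta>"
    using a_asymp b_asymp by (simp_all add: asymp1_def)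
  have w: "asymp1 (\<lambda>n. jweight a b \<gamma> n / real n powr \<sigma>) 0 \<tau>"
    unfolding tau by (rule asymp1_jweight[OF a b gamma])
  {
    assume "\<tau> < 0"
    then have "- \<tau> > 0" by simp
    \<comment> \<open>The decay exponent \<open>s = \<sigma> - 1/2\<close> must exceed
      \<open>1\<close> for the squared solutions to be summable.\<close>
    moreover have "\<sigma> - 1/2 > 1" using sigma by simp
    moreover have "asymp1 (\<lambda>n. a n / real n powr (\<sigma> - 1/2 + 1/2)) 1 \<alpha>"
      and "asymp1 (\<lambda>n. jweight a b \<gamma> n / real n powr (\<sigma> - 1/2 + 1/2)) 0 (- (- \<tau>))"
      using a w by simp_all
    ultimately show "deficiency_indices (jacobi_min a b) = (1, 1)"
      and "\<forall>A. self_adjoint A \<and> jacobi_min a b \<subseteq> A \<longrightarrow> discrete_spectrum A"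
      using jacobi_limit_circle[where a = a and b = b and g = \<gamma> and \<kappa> = "- \<tau>" and s = "\<sigma> - 1/2" and \<alpha> = \<alpha>,
          OF a_pos gamma] by blast+
  }
  {
    assume "\<tau> > 0"
    then have w': "filterlim (jweight a b \<gamma>) at_top sequentially"
      using sigma by (intro jweight_at_top[OF w]) auto
    \<comment> \<open>The spectral bound concerns \<open>\<gamma> * Re z\<close>, so the sign of
      \<open>\<gamma>\<close> decides the side.\<close>
    note semi = closure_jacobi_semibounded[OF a_pos gamma w']
    show "essentially_self_adjoint (jacobi_min a b)" "discrete_spectrum (closure (jacobi_min a b))"
      using semi(1,2) by (simp_all add: essentially_self_adjoint_def)
    show "bdd_below (Re ` spectrum (closure (jacobi_min a b)))" if "\<gamma> = 1"
      using semi(3) that by (auto simp: bdd_below_def)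
    show "bdd_above (Re ` spectrum (closure (jacobi_min a b)))" if "\<gamma> = - 1"
    proof -
      obtain C where C: "\<And>z. z \<in> spectrum (closure (jacobi_min a b)) \<Longrightarrow> C \<le> \<gamma> * Re z"
        using semi(3) by blast
      then have "Re z \<le> - C" if "z \<in> spectrum (closure (jacobi_min a b))" for z
        using C[OF that] \<open>\<gamma> = - 1\<close> by simp
      then show ?thesis
        by (intro bdd_aboveI[of _ "- C"]) auto
    qed
  }
qed

end
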